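(* Let $A$ be an algebra in a strict monoidal category $\mathcal C$, let $\mathcal D$ be a right $\mathcal C$-category and let $(A,X,\psi)$ be a cowreath in $\mathcal C$. If $X\dashv Y$ in $\mathcal C$, then the category $\mathcal D(\psi)_A^X$ of entwined modules in $\mathcal D$ over $(A,X,\psi)$ and the category $\mathcal D_{YA}$ of right modules in $\mathcal D$ over the wreath product algebra $YA$ are isomorphic.
   Context: Conventions: $\mathcal C$ is a strict monoidal category with unit object $\underline 1$; the tensor product is written by juxtaposition ($XY=X\otimes Y$, $fg=f\otimes g$), and the identity morphism of $X$ is written $X$ (so $fA=f\otimes \mathrm{Id}_A$). $(A,m,\eta)$ is an algebra in $\mathcal C$. A right $\mathcal C$-category $\mathcal D$ is a category with a (strictly) associative and unital right action $\mathcal D\times\mathcal C\to\mathcal D$, $(M,X)\mapsto MX$ (right module category). For an algebra $S$ in $\mathcal C$, $\mathcal D_S$ is the category of right $S$-modules $(M,\mu:MS\to M)$ in $\mathcal D$. Adjunction: $X\dashv Y$ in $\mathcal C$ means there are $b:\underline 1\to YX$ and $d:XY\to\underline 1$ with $Yd\circ bY=Y$ and $dX\circ Xb=X$. Transfer morphisms: $\mathcal T_A^\#$ has as objects the pairs $(X,\psi)$, $X\in\mathcal C$, $\psi:XA\to AX$ with $\psi\circ Xm=mX\circ A\psi\circ\psi A$ and $\psi\circ X\eta=\eta X$. A morphism $(X,\psi_X)\to(Y,\psi_Y)$ is a morphism $f:X\to AY$ in $\mathcal C$ with $mY\circ Af\circ\psi_X=mY\circ A\psi_Y\circ fA$; composition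 is $g\bullet f=mZ\circ Ag\circ f$, identity of $X$ is $\eta X$; the tensor product of objects is $(XY,\psi_XY\circ X\psi_Y)$, that of morphisms $f:X\to AX'$, $g:Y\to AY'$ is $mX'Y'\circ A\psi_{X'}Y'\circ fg$, and the unit object is $(\underline 1,A)$. It is strict monoidal. Cowreath: $(A,X,\psi)$ with $A$ an algebra and $(X,\psi)$ a coalgebra in $\mathcal T_A^\#$; explicitly there are $\delta:X\to AXX$, $\epsilon:X\to A$ in $\mathcal C$ with $mXX\circ A\psi X\circ AX\psi\circ\delta A=mXX\circ A\delta\circ\psi$; $mXXX\circ A\delta X\circ\delta=mXXX\circ A\psi XX\circ AX\delta\circ\delta$; $m\circ A\epsilon\circ\psi=m\circ\epsilon A$; $mX\circ A\epsilon X\circ\delta=\eta X=mX\circ A\psi\circ AX\epsilon\circ\delta$. Entwined modules: objects of $\mathcal D(\psi)_A^X$ are $(M,\mu,\rho)$ with $(M,\mu)\in\mathcal D_A$ and $\rho:M\to MX$ such that $\rho\circ\mu=\mu X\circ M\psi\circ\rho A$, $\rho X\circ\rho=\mu XX\circ M\delta\circ\rho$, $\mu\circ M\epsilon\circ\rho=M$. Morphisms are right $A$-linear $f$ with $fX\circ\rho=\rho\circ f$. Wreath product algebra: if $(A,X,\psi)$ is a cowreath and $X\dashv Y$, then $YA$ is an algebra in $\mathcal C$ with multiplication $m_\#=Ym\circ YmA\circ YAAdA\circ YA\psi YA\circ YAXdAYA\circ Y\delta YAYA\circ bYAYA:YAYA\to YA$ and unit $\eta_\#=Y\epsilon\circ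 b:\underline 1\to YA$. *)

theory Defs
  imports Main
begin

section \<open>Categories and isomorphism of categories\<close>

text \<open>
  Categories have explicit carriers and every arrow determines its domain and codomain.
  No condition is imposed on values outside the carriers.  Composition is written in the usual
  (right to left) order.
\<close>

record ('o, 'm) cat =
  Ob :: "'o set"
  Ar :: "'m set"
  Dom :: "'m \<Rightarrow> 'o"
  Cod :: "'m \<Rightarrow> 'o"
  Idt :: "'o \<Rightarrow> 'm"  ("Id\<index>")
  Cmp :: "'m \<Rightarrow> 'm \<Rightarrow> 'm"  (infixr "\<cdot>\<index>" 60)

definition hom :: "('o, 'm, 'x) cat_scheme \<Rightarrow> 'o \<Rightarrow> 'o \<Rightarrow> 'm set"  ("hom\<index>")
  where "hom\<^bsub>C\<^esub> X Y = {f \<in> Ar C. Dom C f = X \<and> Cod C f = Y}"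

locale category =
  fixes C :: "('o, 'm, 'x) cat_scheme" (structure)
  assumes Dom_Ob: "f \<in> Ar C \<Longrightarrow> Dom C f \<in> Ob C"
    and Cod_Ob: "f \<in> Ar C \<Longrightarrow> Cod C f \<in> Ob C"
    and Id_hom: "X \<in> Ob C \<Longrightarrow> Id X \<in> hom X X"
    and comp_hom: "\<lbrakk>g \<in> hom Y Z; f \<in> hom X Y\<rbrakk> \<Longrightarrow> g \<cdot> f \<in> hom X Z"
    and comp_Id: "f \<in> hom X Y \<Longrightarrow> f \<cdot> Id X = f"
    and Id_comp: "f \<in> hom X Y \<Longrightarrow> Id Y \<cdot> f = f"
    and comp_assoc: "\<lbrakk>h \<in> hom Z W; g \<in> hom Y Z; f \<in> hom X Y\<rbrakk> \<Longrightarrow> (h \<cdot> g) \<cdot> f = h \<cdot> (g \<cdot> f)"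

locale cat_functor = source: category C + target: category D
  for C :: "('o, 'm, 'x) cat_scheme" and D :: "('p, 'n, 'y) cat_scheme" +
  fixes Fo :: "'o \<Rightarrow> 'p" and Fa :: "'m \<Rightarrow> 'n"
  assumes functor_Ob: "X \<in> Ob C \<Longrightarrow> Fo X \<in> Ob D"
    and functor_hom: "f \<in> hom\<^bsub>C\<^esub> X Y \<Longrightarrow> Fa f \<in> hom\<^bsub>D\<^esub> (Fo X) (Fo Y)"
    and functor_Id: "X \<in> Ob C \<Longrightarrow> Fa (Id\<^bsub>C\<^esub> X) = Id\<^bsub>D\<^esub> (Fo X)"
    and functor_comp:
      "\<lbrakk>g \<in> hom\<^bsub>C\<^esub> Y Z; f \<in> hom\<^bsub>C\<^esub> X Y\<rbrakk> \<Longrightarrow> Fa (g \<cdot>\<^bsub>C\<^esub> f) = Fa g \<cdot>\<^bsub>D\<^esub> Fa f"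

definition isomorphic_categories ::
    "('o, 'm, 'x) cat_scheme \<Rightarrow> ('p, 'n, 'y) cat_scheme \<Rightarrow> bool"
  where "isomorphic_categories C D \<longleftrightarrow>
    (\<exists>Fo Fa Go Ga. cat_functor C D Fo Fa \<and> cat_functor D C Go Ga \<and>
      (\<forall>X\<in>Ob C. Go (Fo X) = X) \<and> (\<forall>f\<in>Ar C. Ga (Fa f) = f) \<and>
      (\<forall>Y\<in>Ob D. Fo (Go Y) = Y) \<and> (\<forall>g\<in>Ar D. Fa (Ga g) = g))"


section \<open>Strict monoidal categories and right actions\<close>

record ('o, 'm) moncat = "('o, 'm) cat" +
  Unit :: "'o"  ("\<one>\<index>")
  TenO :: "'o \<Rightarrow> 'o \<Rightarrow> 'o"  (infixr "\<otimes>\<index>" 80)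
  TenA :: "'m \<Rightarrow> 'm \<Rightarrow> 'm"  (infixr "\<boxtimes>\<index>" 80)

abbreviation whisker_left :: "('o, 'm, 'x) moncat_scheme \<Rightarrow> 'o \<Rightarrow> 'm \<Rightarrow> 'm"  (infixr "\<lhd>\<index>" 70)
  where "X \<lhd>\<^bsub>C\<^esub> f \<equiv> Id\<^bsub>C\<^esub> X \<boxtimes>\<^bsub>C\<^esub> f"

abbreviation whisker_right :: "('o, 'm, 'x) moncat_scheme \<Rightarrow> 'm \<Rightarrow> 'o \<Rightarrow> 'm"  (infixl "\<rhd>\<index>" 75)
  where "f \<rhd>\<^bsub>C\<^esub> X \<equiv> f \<boxtimes>\<^bsub>C\<^esub> Id\<^bsub>C\<^esub> X"

locale strict_monoidal_category = category C
  for C :: "('o, 'm, 'x) moncat_scheme" (structure) +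
  assumes unit_Ob: "\<one> \<in> Ob C"
    and tensor_Ob: "\<lbrakk>X \<in> Ob C; Y \<in> Ob C\<rbrakk> \<Longrightarrow> X \<otimes> Y \<in> Ob C"
    and tensor_hom: "\<lbrakk>f \<in> hom X X'; g \<in> hom Y Y'\<rbrakk> \<Longrightarrow> f \<boxtimes> g \<in> hom (X \<otimes> Y) (X' \<otimes> Y')"
    and tensor_Id: "\<lbrakk>X \<in> Ob C; Y \<in> Ob C\<rbrakk> \<Longrightarrow> Id X \<boxtimes> Id Y = Id (X \<otimes> Y)"
    and tensor_comp:
      "\<lbrakk>f' \<in> hom X' X''; f \<in> hom X X'; g' \<in> hom Y' Y''; g \<in> hom Y Y'\<rbrakk>
        \<Longrightarrow> (f' \<cdot> f) \<boxtimes> (g' \<cdot> g) = (f' \<boxtimes> g') \<cdot> (f \<boxtimes> g)"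
    and tensor_assoc_Ob:
      "\<lbrakk>X \<in> Ob C; Y \<in> Ob C; Z \<in> Ob C\<rbrakk> \<Longrightarrow> (X \<otimes> Y) \<otimes> Z = X \<otimes> (Y \<otimes> Z)"
    and tensor_assoc_Ar:
      "\<lbrakk>f \<in> Ar C; g \<in> Ar C; h \<in> Ar C\<rbrakk> \<Longrightarrow> (f \<boxtimes> g) \<boxtimes> h = f \<boxtimes> (g \<boxtimes> h)"
    and tensor_unit_Ob: "X \<in> Ob C \<Longrightarrow> \<one> \<otimes> X = X" "X \<in> Ob C \<Longrightarrow> X \<otimes> \<one> = X"
    and tensor_unit_Ar: "f \<in> Ar C \<Longrightarrow> Id \<one> \<boxtimes> f = f" "f \<in> Ar C \<Longrightarrow> f \<boxtimes> Id \<one> = f"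

record ('d, 'n, 'o, 'm) actcat = "('d, 'n) cat" +
  ActO :: "'d \<Rightarrow> 'o \<Rightarrow> 'd"  (infixl "\<odot>\<index>" 78)
  ActA :: "'n \<Rightarrow> 'm \<Rightarrow> 'n"  (infixl "\<boxdot>\<index>" 78)

locale right_monoidal_action = strict_monoidal_category C + module: category D
  for C :: "('o, 'm, 'x) moncat_scheme" (structure)
    and D :: "('d, 'n, 'o, 'm, 'y) actcat_scheme" +
  assumes act_Ob: "\<lbrakk>M \<in> Ob D; X \<in> Ob C\<rbrakk> \<Longrightarrow> M \<odot>\<^bsub>D\<^esub> X \<in> Ob D"
    and act_hom:
      "\<lbrakk>u \<in> hom\<^bsub>D\<^esub> M M'; f \<in> hom X X'\<rbrakk> \<Longrightarrow> u \<boxdot>\<^bsub>D\<^esub> f \<in> hom\<^bsub>D\<^esub> (M \<odot>\<^bsub>D\<^esub> X) (M' \<odot>\<^bsub>D\<^esub> X')"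
    and act_Id: "\<lbrakk>M \<in> Ob D; X \<in> Ob C\<rbrakk> \<Longrightarrow> Id\<^bsub>D\<^esub> M \<boxdot>\<^bsub>D\<^esub> Id X = Id\<^bsub>D\<^esub> (M \<odot>\<^bsub>D\<^esub> X)"
    and act_comp:
      "\<lbrakk>u' \<in> hom\<^bsub>D\<^esub> M' M''; u \<in> hom\<^bsub>D\<^esub> M M'; f' \<in> hom X' X''; f \<in> hom X X'\<rbrakk>
        \<Longrightarrow> (u' \<cdot>\<^bsub>D\<^esub> u) \<boxdot>\<^bsub>D\<^esub> (f' \<cdot> f) = (u' \<boxdot>\<^bsub>D\<^esub> f') \<cdot>\<^bsub>D\<^esub> (u \<boxdot>\<^bsub>D\<^esub> f)"
    and act_assoc_Ob:
      "\<lbrakk>M \<in> Ob D; X \<in> Ob C; Y \<in> Ob C\<rbrakk> \<Longrightarrow> (M \<odot>\<^bsub>D\<^esub> X) \<odot>\<^bsub>D\<^esub> Y = M \<odot>\<^bsub>D\<^esub> (X \<otimes> Y)"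
    and act_assoc_Ar:
      "\<lbrakk>u \<in> Ar D; f \<in> Ar C; g \<in> Ar C\<rbrakk> \<Longrightarrow> (u \<boxdot>\<^bsub>D\<^esub> f) \<boxdot>\<^bsub>D\<^esub> g = u \<boxdot>\<^bsub>D\<^esub> (f \<boxtimes> g)"
    and act_unit_Ob: "M \<in> Ob D \<Longrightarrow> M \<odot>\<^bsub>D\<^esub> \<one> = M"
    and act_unit_Ar: "u \<in> Ar D \<Longrightarrow> u \<boxdot>\<^bsub>D\<^esub> Id \<one> = u"


section \<open>Algebras, coalgebras, adjunctions and cowreaths\<close>

context
  fixes C :: "('o, 'm, 'x) moncat_scheme" (structure)
begin

definition algebra :: "'o \<Rightarrow> 'm \<Rightarrow> 'm \<Rightarrow> bool"
  where "algebra A m \<eta> \<longleftrightarrow>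
    A \<in> Ob C \<and> m \<in> hom (A \<otimes> A) A \<and> \<eta> \<in> hom \<one> A \<and>
    m \<cdot> (m \<rhd> A) = m \<cdot> (A \<lhd> m) \<and>
    m \<cdot> (\<eta> \<rhd> A) = Id A \<and> m \<cdot> (A \<lhd> \<eta>) = Id A"

definition coalgebra :: "'o \<Rightarrow> 'm \<Rightarrow> 'm \<Rightarrow> bool"
  where "coalgebra X \<delta> \<epsilon> \<longleftrightarrow>
    X \<in> Ob C \<and> \<delta> \<in> hom X (X \<otimes> X) \<and> \<epsilon> \<in> hom X \<one> \<and>
    (\<delta> \<rhd> X) \<cdot> \<delta> = (X \<lhd> \<delta>) \<cdot> \<delta> \<and>
    (\<epsilon> \<rhd> X) \<cdot> \<delta> = Id X \<and> (X \<lhd> \<epsilon>) \<cdot> \<delta> = Id X"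

definition adjunction :: "'o \<Rightarrow> 'o \<Rightarrow> 'm \<Rightarrow> 'm \<Rightarrow> bool"
  where "adjunction X Y b d \<longleftrightarrow>
    X \<in> Ob C \<and> Y \<in> Ob C \<and> b \<in> hom \<one> (Y \<otimes> X) \<and> d \<in> hom (X \<otimes> Y) \<one> \<and>
    (Y \<lhd> d) \<cdot> (b \<rhd> Y) = Id Y \<and> (d \<rhd> X) \<cdot> (X \<lhd> b) = Id X"

definition transfer_Ob :: "'o \<Rightarrow> 'm \<Rightarrow> 'm \<Rightarrow> ('o \<times> 'm) set"
  where "transfer_Ob A m \<eta> = {(X, \<psi>).
    X \<in> Ob C \<and> \<psi> \<in> hom (X \<otimes> A) (A \<otimes> X) \<and>
    \<psi> \<cdot> (X \<lhd> m) = (m \<rhd> X) \<cdot> (A \<lhd> \<psi>) \<cdot> (\<psi> \<rhd> A) \<and>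
    \<psi> \<cdot> (X \<lhd> \<eta>) = \<eta> \<rhd> X}"

text \<open>
  The strict monoidal category of transfer morphisms through the algebra \<open>(A, m, \<eta>)\<close>.
  A transfer morphism is a morphism \<open>f : X \<rightarrow> A \<otimes> Y\<close> of \<open>C\<close> tagged with its source
  \<open>(X, \<psi>)\<close> and target \<open>(Y, \<phi>)\<close>, so that domain and codomain can be read off.
\<close>

definition transfer_category ::
    "'o \<Rightarrow> 'm \<Rightarrow> 'm \<Rightarrow> ('o \<times> 'm, ('o \<times> 'm) \<times> 'm \<times> ('o \<times> 'm)) moncat"
  where "transfer_category A m \<eta> = \<lparr>
    Ob = transfer_Ob A m \<eta>,
    Ar = {((X, \<psi>), f, (Y, \<phi>)) | X \<psi> f Y \<phi>.
      (X, \<psi>) \<in> transfer_Ob A m \<eta> \<and> (Y, \<phi>) \<in> transfer_Ob A m \<eta> \<and> f \<in> hom X (A \<otimes> Y) \<and>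
      (m \<rhd> Y) \<cdot> (A \<lhd> f) \<cdot> \<psi> = (m \<rhd> Y) \<cdot> (A \<lhd> \<phi>) \<cdot> (f \<rhd> A)},
    Dom = (\<lambda>(S, f, T). S),
    Cod = (\<lambda>(S, f, T). T),
    Idt = (\<lambda>(X, \<psi>). ((X, \<psi>), \<eta> \<rhd> X, (X, \<psi>))),
    Cmp = (\<lambda>(_, g, (Z, \<zeta>)) (S, f, _). (S, (m \<rhd> Z) \<cdot> (A \<lhd> g) \<cdot> f, (Z, \<zeta>))),
    Unit = (\<one>, Id A),
    TenO = (\<lambda>(X, \<psi>) (Y, \<phi>). (X \<otimes> Y, (\<psi> \<rhd> Y) \<cdot> (X \<lhd> \<phi>))),
    TenA = (\<lambda>((X, \<psi>), f, (X', \<psi>')) ((Y, \<phi>), g, (Y', \<phi>')).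
      ((X \<otimes> Y, (\<psi> \<rhd> Y) \<cdot> (X \<lhd> \<phi>)),
       (m \<rhd> X' \<otimes> Y') \<cdot> (A \<lhd> \<psi>' \<rhd> Y') \<cdot> (f \<boxtimes> g),
       (X' \<otimes> Y', (\<psi>' \<rhd> Y') \<cdot> (X' \<lhd> \<phi>')))) \<rparr>"

end

definition cowreath ::
    "('o, 'm, 'x) moncat_scheme \<Rightarrow> 'o \<Rightarrow> 'm \<Rightarrow> 'm \<Rightarrow> 'o \<Rightarrow> 'm \<Rightarrow> 'm \<Rightarrow> 'm \<Rightarrow> bool"
  where "cowreath C A m \<eta> X \<psi> \<delta> \<epsilon> \<longleftrightarrow>
    algebra C A m \<eta> \<and>
    (let T = transfer_category C A m \<eta> in
      coalgebra T (X, \<psi>) ((X, \<psi>), \<delta>, (X, \<psi>) \<otimes>\<^bsub>T\<^esub> (X, \<psi>)) ((X, \<psi>), \<epsilon>, \<one>\<^bsub>T\<^esub>))"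


section \<open>The explicit form of a cowreath\<close>

text \<open>
  The lemma \<open>cowreath_iff\<close> unfolds the coalgebra structure in the transfer category into
  morphisms and equations of \<open>C\<close>.  The lemmas before it are only used in its proof.
\<close>

context strict_monoidal_category begin

lemma hom_iff: "f \<in> hom X Y \<longleftrightarrow> f \<in> Ar C \<and> Dom C f = X \<and> Cod C f = Y"
  by (simp add: hom_def)

lemma ar_id: "X \<in> Ob C \<Longrightarrow> Id X \<in> Ar C" "X \<in> Ob C \<Longrightarrow> Dom C (Id X) = X" "X \<in> Ob C \<Longrightarrow> Cod C (Id X) = X"
  using Id_hom by (auto simp: hom_iff)

lemma ar_comp: assumes "f \<in> Ar C" "g \<in> Ar C" "Dom C g = Cod C f"
  shows "g \<cdot> f \<in> Ar C" "Dom C (g \<cdot> f) = Dom C f" "Cod C (g \<cdot> f) = Cod C g"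
  using comp_hom[of g "Cod C f" "Cod C g" f "Dom C f"] assms by (auto simp: hom_iff)

lemma ar_ten: assumes "f \<in> Ar C" "g \<in> Ar C"
  shows "f \<boxtimes> g \<in> Ar C" "Dom C (f \<boxtimes> g) = Dom C f \<otimes> Dom C g" "Cod C (f \<boxtimes> g) = Cod C f \<otimes> Cod C g"
  using tensor_hom[of f "Dom C f" "Cod C f" g] assms by (auto simp: hom_iff)

lemma ar_unit: assumes "f \<in> Ar C" shows "f \<cdot> Id (Dom C f) = f" "Id (Cod C f) \<cdot> f = f"
  using comp_Id Id_comp assms by (auto simp: hom_iff)
lemma ar_unit': assumes "f \<in> Ar C" shows "Dom C f = X \<Longrightarrow> f \<cdot> Id X = f" "Cod C f = X \<Longrightarrow> Id X \<cdot> f = f"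
  using ar_unit assms by auto

lemma ar_assoc: assumes "f \<in> Ar C" "g \<in> Ar C" "h \<in> Ar C" "Dom C g = Cod C f" "Dom C h = Cod C g"
  shows "(h \<cdot> g) \<cdot> f = h \<cdot> (g \<cdot> f)"
  using comp_assoc assms by (auto simp: hom_iff)

lemma inter: assumes "f \<in> Ar C" "g \<in> Ar C" "f' \<in> Ar C" "g' \<in> Ar C" "Dom C f' = Cod C f" "Dom C g' = Cod C g"
  shows "(f' \<cdot> f) \<boxtimes> (g' \<cdot> g) = (f' \<boxtimes> g') \<cdot> (f \<boxtimes> g)" 
  using tensor_comp[of f' "Cod C f" _ f _ g' "Cod C g"] assms by (auto simp: hom_iff)

lemma dist_l: assumes "X \<in> Ob C" "g \<in> Ar C" "g' \<in> Ar C"  "Dom C g' = Cod C g"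
  shows "X \<lhd> (g' \<cdot> g) = (X \<lhd> g') \<cdot> (X \<lhd> g)"
  using inter[of "Id X" g "Id X" g'] assms by (simp add: ar_id ar_unit')
lemma dist_r: assumes "X \<in> Ob C" "g \<in> Ar C" "g' \<in> Ar C"  "Dom C g' = Cod C g"
  shows "(g' \<cdot> g) \<rhd> X = (g' \<rhd> X) \<cdot> (g \<rhd> X)"
  using inter[of g "Id X" g' "Id X" ] assms by (simp add: ar_id ar_unit')
lemma exch: assumes "f \<in> Ar C" "g \<in> Ar C" 
  shows "f \<boxtimes> g = (Cod C f \<lhd> g) \<cdot> (f \<rhd> Dom C g)" "f \<boxtimes> g = (f \<rhd> Cod C g) \<cdot> (Dom C f \<lhd> g)"
  using inter[of f "Id (Dom C g)" "Id (Cod C f)" g] inter[of "Id (Dom C f)" g f "Id (Cod C g)"] assms 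
  by (simp_all add: ar_id ar_unit' Dom_Ob Cod_Ob)

lemmas basics = ar_id ar_comp ar_ten ar_unit' unit_Ob tensor_Ob tensor_assoc_Ob tensor_unit_Ob tensor_unit_Ar
   tensor_Id Dom_Ob Cod_Ob

lemma idl: assumes "X \<in> Ob C" "Y \<in> Ob C" "f \<in> Ar C" shows "X \<lhd> (Y \<lhd> f) = X \<otimes> Y \<lhd> f"
  "(f \<rhd> X) \<rhd> Y = f \<rhd> X \<otimes> Y" "(X \<lhd> f) \<rhd> Y = X \<lhd> f \<rhd> Y"
  using tensor_assoc_Ar[of "Id X" "Id Y" f] tensor_assoc_Ar[of f "Id X" "Id Y"] tensor_assoc_Ar[of "Id X" f "Id Y"] assms
  by (simp_all add: ar_id tensor_Id)

lemma tens_right: 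
  assumes alg: "algebra C A m \<eta>" and X: "X \<in> Ob C" "Z \<in> Ob C" "(Y,\<phi>) \<in> transfer_Ob C A m \<eta>" and f: "f \<in> hom Z (A \<otimes> Y)"
  shows "(m \<rhd> Y \<otimes> X) \<cdot> (A \<lhd> \<phi> \<rhd> X) \<cdot> (f \<boxtimes> (\<eta> \<rhd> X)) = f \<rhd> X"
proof -
  from alg X f have A: "A \<in> Ob C" "Y \<in> Ob C" and m: "m \<in> Ar C" "Dom C m = A \<otimes> A" "Cod C m = A" and e: "\<eta> \<in> Ar C" "Dom C \<eta> = \<one>" "Cod C \<eta> = A"
    and p: "\<phi> \<in> Ar C" "Dom C \<phi> = Y \<otimes> A" "Cod C \<phi> = A \<otimes> Y" and pe: "\<phi> \<cdot> (Y \<lhd> \<eta>) = \<eta> \<rhd> Y"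
    and me: "m \<cdot> (A \<lhd> \<eta>) = Id A" and F: "f \<in> Ar C" "Dom C f = Z" "Cod C f = A \<otimes> Y"
    by (auto simp: algebra_def transfer_Ob_def hom_iff)
  note b = basics A X(1,2) m e p F
  have "f \<boxtimes> (\<eta> \<rhd> X) = (A \<otimes> Y \<lhd> \<eta> \<rhd> X) \<cdot> (f \<rhd> X)"
    using exch(1)[of f "\<eta> \<rhd> X"] by (simp add: b)
  moreover have "(A \<lhd> \<phi> \<rhd> X) \<cdot> (A \<otimes> Y \<lhd> \<eta> \<rhd> X) = A \<lhd> \<eta> \<rhd> Y \<otimes> X"
  proof -
    have "(A \<lhd> \<phi> \<rhd> X) \<cdot> (A \<otimes> Y \<lhd> \<eta> \<rhd> X) = A \<lhd> (\<phi> \<cdot> (Y \<lhd> \<eta>)) \<rhd> X"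
      by (simp add: b dist_l dist_r idl)
    then show ?thesis by (simp add: pe b idl)
  qed
  moreover have "(m \<rhd> Y \<otimes> X) \<cdot> (A \<lhd> \<eta> \<rhd> Y \<otimes> X) = Id (A \<otimes> Y \<otimes> X)"
  proof -
    have "(m \<rhd> Y \<otimes> X) \<cdot> (A \<lhd> \<eta> \<rhd> Y \<otimes> X) = (m \<cdot> (A \<lhd> \<eta>)) \<rhd> Y \<otimes> X"
      by (simp add: b dist_r idl)
    then show ?thesis by (simp add: me b)
  qed
  ultimately show ?thesis
    by (simp add: b ar_assoc[symmetric])
qed

lemma tens_left: 
  assumes alg: "algebra C A m \<eta>" and X: "(X,\<psi>) \<in> transfer_Ob C A m \<eta>" "Y \<in> Ob C" "Z \<in> Ob C" and f: "f \<in> hom Z (A \<otimes> Y)"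
  shows "(m \<rhd> X \<otimes> Y) \<cdot> (A \<lhd> \<psi> \<rhd> Y) \<cdot> ((\<eta> \<rhd> X) \<boxtimes> f) = (\<psi> \<rhd> Y) \<cdot> (X \<lhd> f)"
proof -
  from alg X f have A: "A \<in> Ob C" "X \<in> Ob C" and m: "m \<in> Ar C" "Dom C m = A \<otimes> A" "Cod C m = A" and e: "\<eta> \<in> Ar C" "Dom C \<eta> = \<one>" "Cod C \<eta> = A"
    and p: "\<psi> \<in> Ar C" "Dom C \<psi> = X \<otimes> A" "Cod C \<psi> = A \<otimes> X" 
    and me: "m \<cdot> (\<eta> \<rhd> A) = Id A" and F: "f \<in> Ar C" "Dom C f = Z" "Cod C f = A \<otimes> Y"
    by (auto simp: algebra_def transfer_Ob_def hom_iff)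
  note b = basics A X(2,3) m e p F
  have "(\<eta> \<rhd> X) \<boxtimes> f = \<eta> \<boxtimes> (X \<lhd> f)" by (simp add: b tensor_assoc_Ar)
  then have 1: "(\<eta> \<rhd> X) \<boxtimes> f = (\<eta> \<rhd> X \<otimes> A \<otimes> Y) \<cdot> (X \<lhd> f)" 
    using exch(2)[of \<eta> "X \<lhd> f"] by (simp add: b)
  have 2: "(A \<lhd> \<psi> \<rhd> Y) \<cdot> (\<eta> \<rhd> X \<otimes> A \<otimes> Y) = (\<eta> \<rhd> A \<otimes> X \<otimes> Y) \<cdot> (\<psi> \<rhd> Y)"
    using exch(1)[of \<eta> "\<psi> \<rhd> Y"] exch(2)[of \<eta> "\<psi> \<rhd> Y"] by (simp add: b)
  have 3: "(m \<rhd> X \<otimes> Y) \<cdot> (\<eta> \<rhd> A \<otimes> X \<otimes> Y) = Id (A \<otimes> X \<otimes> Y)"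
  proof -
    have "(m \<rhd> X \<otimes> Y) \<cdot> (\<eta> \<rhd> A \<otimes> X \<otimes> Y) = (m \<cdot> (\<eta> \<rhd> A)) \<rhd> X \<otimes> Y"
      by (simp add: b dist_r idl)
    then show ?thesis by (simp add: me b)
  qed
  show ?thesis
    unfolding 1
    apply (subst ar_assoc[symmetric, of "X \<lhd> f"]) apply (simp_all add: b)
    unfolding 2
    apply (subst ar_assoc[of "X \<lhd> f"]) apply (simp_all add: b)
    apply (subst ar_assoc[symmetric]) apply (simp_all add: b)
    by (simp add: 3 b)
qed


lemma unit_TO: assumes alg: "algebra C A m \<eta>" shows "(\<one>, Id A) \<in> transfer_Ob C A m \<eta>"
  using assms by (auto simp: algebra_def transfer_Ob_def hom_iff basics)

lemma tens_TO: assumes alg: "algebra C A m \<eta>" and x: "(X,\<psi>) \<in> transfer_Ob C A m \<eta>" "(Y,\<phi>) \<in> transfer_Ob C A m \<eta>"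
  shows "(X \<otimes> Y, (\<psi> \<rhd> Y) \<cdot> (X \<lhd> \<phi>)) \<in> transfer_Ob C A m \<eta>"
proof -
  from alg x have A: "A \<in> Ob C" "X \<in> Ob C" "Y \<in> Ob C" and m: "m \<in> Ar C" "Dom C m = A \<otimes> A" "Cod C m = A" and e: "\<eta> \<in> Ar C" "Dom C \<eta> = \<one>" "Cod C \<eta> = A"
    and p: "\<psi> \<in> Ar C" "Dom C \<psi> = X \<otimes> A" "Cod C \<psi> = A \<otimes> X" 
    and q: "\<phi> \<in> Ar C" "Dom C \<phi> = Y \<otimes> A" "Cod C \<phi> = A \<otimes> Y" 
    and pe: "\<phi> \<cdot> (Y \<lhd> \<eta>) = \<eta> \<rhd> Y" "\<psi> \<cdot> (X \<lhd> \<eta>) = \<eta> \<rhd> X"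
    and pm: "\<phi> \<cdot> (Y \<lhd> m) = (m \<rhd> Y) \<cdot> (A \<lhd> \<phi>) \<cdot> (\<phi> \<rhd> A)" "\<psi> \<cdot> (X \<lhd> m) = (m \<rhd> X) \<cdot> (A \<lhd> \<psi>) \<cdot> (\<psi> \<rhd> A)"
    by (auto simp: algebra_def transfer_Ob_def hom_iff)
  note b = basics A m e p q
  have "((\<psi> \<rhd> Y) \<cdot> (X \<lhd> \<phi>)) \<cdot> (X \<otimes> Y \<lhd> \<eta>) = (\<psi> \<rhd> Y) \<cdot> (X \<lhd> (\<phi> \<cdot> (Y \<lhd> \<eta>)))"
    by (simp add: b ar_assoc dist_l idl)
  also have "\<dots> = (\<psi> \<cdot> (X \<lhd> \<eta>)) \<rhd> Y" unfolding pe(1) by (simp add: b dist_r idl)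
  also have "\<dots> = \<eta> \<rhd> X \<otimes> Y" unfolding pe by (simp add: b idl)
  finally have 1: "((\<psi> \<rhd> Y) \<cdot> (X \<lhd> \<phi>)) \<cdot> (X \<otimes> Y \<lhd> \<eta>) = \<eta> \<rhd> X \<otimes> Y" .
  have "((\<psi> \<rhd> Y) \<cdot> (X \<lhd> \<phi>)) \<cdot> (X \<otimes> Y \<lhd> m) = (\<psi> \<rhd> Y) \<cdot> (X \<lhd> (\<phi> \<cdot> (Y \<lhd> m)))"
    by (simp add: b ar_assoc dist_l idl)
  also have "\<dots> = ((\<psi> \<cdot> (X \<lhd> m)) \<rhd> Y) \<cdot> (X \<otimes> A \<lhd> \<phi>) \<cdot> (X \<lhd> \<phi> \<rhd> A)"
    unfolding pm(1) by (simp add: b dist_r dist_l idl ar_assoc)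
  also have "\<dots> = (m \<rhd> X \<otimes> Y) \<cdot> (A \<lhd> \<psi> \<rhd> Y) \<cdot> ((\<psi> \<rhd> A \<otimes> Y) \<cdot> (X \<otimes> A \<lhd> \<phi>)) \<cdot> (X \<lhd> \<phi> \<rhd> A)"
    unfolding pm by (simp add: b dist_r dist_l idl ar_assoc)
  also have "(\<psi> \<rhd> A \<otimes> Y) \<cdot> (X \<otimes> A \<lhd> \<phi>) = (A \<otimes> X \<lhd> \<phi>) \<cdot> (\<psi> \<rhd> Y \<otimes> A)"
    using exch[of \<psi> \<phi>] by (simp add: b)
  finally have 2: "((\<psi> \<rhd> Y) \<cdot> (X \<lhd> \<phi>)) \<cdot> (X \<otimes> Y \<lhd> m) = 
     (m \<rhd> X \<otimes> Y) \<cdot> (A \<lhd> ((\<psi> \<rhd> Y) \<cdot> (X \<lhd> \<phi>))) \<cdot> (((\<psi> \<rhd> Y) \<cdot> (X \<lhd> \<phi>)) \<rhd> A)"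
    by (simp add: b dist_r dist_l idl ar_assoc)
  show ?thesis using 1 2 by (auto simp: transfer_Ob_def hom_iff b)
qed

lemma cowreath_iff:
  "cowreath C A m \<eta> X \<psi> \<delta> \<epsilon> \<longleftrightarrow>
    algebra C A m \<eta> \<and> (X, \<psi>) \<in> transfer_Ob C A m \<eta> \<and> \<delta> \<in> hom X (A \<otimes> X \<otimes> X) \<and> \<epsilon> \<in> hom X A \<and>
    (m \<rhd> X \<otimes> X) \<cdot> (A \<lhd> \<psi> \<rhd> X) \<cdot> (A \<otimes> X \<lhd> \<psi>) \<cdot> (\<delta> \<rhd> A) = (m \<rhd> X \<otimes> X) \<cdot> (A \<lhd> \<delta>) \<cdot> \<psi> \<and>
    (m \<rhd> X \<otimes> X \<otimes> X) \<cdot> (A \<lhd> \<delta> \<rhd> X) \<cdot> \<delta>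
      = (m \<rhd> X \<otimes> X \<otimes> X) \<cdot> (A \<lhd> \<psi> \<rhd> X \<otimes> X) \<cdot> (A \<otimes> X \<lhd> \<delta>) \<cdot> \<delta> \<and>
    m \<cdot> (A \<lhd> \<epsilon>) \<cdot> \<psi> = m \<cdot> (\<epsilon> \<rhd> A) \<and>
    (m \<rhd> X) \<cdot> (A \<lhd> \<epsilon> \<rhd> X) \<cdot> \<delta> = \<eta> \<rhd> X \<and>
    (m \<rhd> X) \<cdot> (A \<lhd> \<psi>) \<cdot> (A \<otimes> X \<lhd> \<epsilon>) \<cdot> \<delta> = \<eta> \<rhd> X"
    (is "_ \<longleftrightarrow> ?E")
proof -
  have ?thesis if alg: "algebra C A m \<eta>" and x: "(X,\<psi>) \<in> transfer_Ob C A m \<eta>" and hd: "\<delta> \<in> hom X (A \<otimes> X \<otimes> X)" and he: "\<epsilon> \<in> hom X A"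
  proof -
    let ?T = "transfer_category C A m \<eta>"
    let ?X = "(X,\<psi>)" let ?d = "(?X, \<delta>, ?X \<otimes>\<^bsub>?T\<^esub> ?X)" let ?e = "(?X, \<epsilon>, \<one>\<^bsub>?T\<^esub>)"
    from alg x hd he have A: "A \<in> Ob C" "X \<in> Ob C" and m: "m \<in> Ar C" "Dom C m = A \<otimes> A" "Cod C m = A" and e: "\<eta> \<in> Ar C" "Dom C \<eta> = \<one>" "Cod C \<eta> = A"
    and p: "\<psi> \<in> Ar C" "Dom C \<psi> = X \<otimes> A" "Cod C \<psi> = A \<otimes> X" 
    and q: "\<delta> \<in> Ar C" "Dom C \<delta> = X" "Cod C \<delta> = A \<otimes> X \<otimes> X" "\<epsilon> \<in> Ar C" "Dom C \<epsilon> = X" "Cod C \<epsilon> = A"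
      by (auto simp: algebra_def transfer_Ob_def hom_iff)
    note b = basics A m e p q
    note TO = x tens_TO[OF alg x x] unit_TO[OF alg]
    note R = tens_right[OF alg A(2,2) TO(2) hd] tens_right[OF alg A(2,2) TO(3) , of \<epsilon>]
    note L = tens_left[OF alg x _ A(2), of "X \<otimes> X" \<delta>] tens_left[OF alg x _ A(2), of \<one> \<epsilon>]
    have d1: "?d \<rhd>\<^bsub>?T\<^esub> ?X = (?X \<otimes>\<^bsub>?T\<^esub> ?X, \<delta> \<rhd> X, (?X \<otimes>\<^bsub>?T\<^esub> ?X) \<otimes>\<^bsub>?T\<^esub> ?X)"
      using R(1) by (simp add: transfer_category_def b)
    have d2: "?X \<lhd>\<^bsub>?T\<^esub> ?d = (?X \<otimes>\<^bsub>?T\<^esub> ?X, (\<psi> \<rhd> X \<otimes> X) \<cdot> (X \<lhd> \<delta>), (?X \<otimes>\<^bsub>?T\<^esub> ?X) \<otimes>\<^bsub>?T\<^esub> ?X)"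
      using L(1) hd by (simp add: transfer_category_def b dist_l dist_r idl ar_assoc)
    have e1: "?e \<rhd>\<^bsub>?T\<^esub> ?X = (?X \<otimes>\<^bsub>?T\<^esub> ?X, \<epsilon> \<rhd> X, ?X)"
      using R(2) he by (simp add: transfer_category_def b)
    have e2: "?X \<lhd>\<^bsub>?T\<^esub> ?e = (?X \<otimes>\<^bsub>?T\<^esub> ?X, \<psi> \<cdot> (X \<lhd> \<epsilon>), ?X)"
      using L(2) he by (simp add: transfer_category_def b)
    show ?thesis unfolding cowreath_def coalgebra_def Let_def d1 d2 e1 e2
      using TO alg
      by (auto simp: transfer_category_def b Defs.hom_def dist_l dist_r idl ar_assoc)
  qed
  moreover have "?E \<Longrightarrow> algebra C A m \<eta> \<and> (X,\<psi>) \<in> transfer_Ob C A m \<eta> \<and> \<delta> \<in> hom X (A \<otimes> X \<otimes> X) \<and> \<epsilon> \<in> hom X A"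
    by simp
  moreover have "cowreath C A m \<eta> X \<psi> \<delta> \<epsilon> \<Longrightarrow> algebra C A m \<eta> \<and> (X,\<psi>) \<in> transfer_Ob C A m \<eta> \<and> \<delta> \<in> hom X (A \<otimes> X \<otimes> X) \<and> \<epsilon> \<in> hom X A"
    by (auto simp: cowreath_def coalgebra_def transfer_category_def Let_def Defs.hom_def algebra_def basics)
  ultimately show ?thesis by blast
qed

end


section \<open>Modules, entwined modules and the wreath product algebra\<close>

context
  fixes C :: "('o, 'm, 'x) moncat_scheme" (structure)
begin

definition right_module ::
    "('d, 'n, 'o, 'm, 'y) actcat_scheme \<Rightarrow> 'o \<Rightarrow> 'm \<Rightarrow> 'm \<Rightarrow> 'd \<Rightarrow> 'n \<Rightarrow> bool"
  where "right_module D S m \<eta> M \<mu> \<longleftrightarrow>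
    M \<in> Ob D \<and> \<mu> \<in> hom\<^bsub>D\<^esub> (M \<odot>\<^bsub>D\<^esub> S) M \<and>
    \<mu> \<cdot>\<^bsub>D\<^esub> (\<mu> \<boxdot>\<^bsub>D\<^esub> Id S) = \<mu> \<cdot>\<^bsub>D\<^esub> (Id\<^bsub>D\<^esub> M \<boxdot>\<^bsub>D\<^esub> m) \<and>
    \<mu> \<cdot>\<^bsub>D\<^esub> (Id\<^bsub>D\<^esub> M \<boxdot>\<^bsub>D\<^esub> \<eta>) = Id\<^bsub>D\<^esub> M"

definition right_linear ::
    "('d, 'n, 'o, 'm, 'y) actcat_scheme \<Rightarrow> 'o \<Rightarrow> 'n \<Rightarrow> 'n \<Rightarrow> 'n \<Rightarrow> bool"
  where "right_linear D S \<mu> \<nu> f \<longleftrightarrow> f \<cdot>\<^bsub>D\<^esub> \<mu> = \<nu> \<cdot>\<^bsub>D\<^esub> (f \<boxdot>\<^bsub>D\<^esub> Id S)"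

text \<open>As above, arrows between (entwined) modules are tagged with their source and target.\<close>

definition module_category ::
    "('d, 'n, 'o, 'm, 'y) actcat_scheme \<Rightarrow> 'o \<Rightarrow> 'm \<Rightarrow> 'm
      \<Rightarrow> ('d \<times> 'n, ('d \<times> 'n) \<times> 'n \<times> ('d \<times> 'n)) cat"
  where "module_category D S m \<eta> = \<lparr>
    Ob = {(M, \<mu>). right_module D S m \<eta> M \<mu>},
    Ar = {((M, \<mu>), f, (N, \<nu>)) | M \<mu> f N \<nu>.
      right_module D S m \<eta> M \<mu> \<and> right_module D S m \<eta> N \<nu> \<and>
      f \<in> hom\<^bsub>D\<^esub> M N \<and> right_linear D S \<mu> \<nu> f},
    Dom = (\<lambda>(P, f, Q). P),
    Cod = (\<lambda>(P, f, Q). Q),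
    Idt = (\<lambda>(M, \<mu>). ((M, \<mu>), Id\<^bsub>D\<^esub> M, (M, \<mu>))),
    Cmp = (\<lambda>(_, g, Q) (P, f, _). (P, g \<cdot>\<^bsub>D\<^esub> f, Q)) \<rparr>"

definition entwined_module ::
    "('d, 'n, 'o, 'm, 'y) actcat_scheme \<Rightarrow> 'o \<Rightarrow> 'm \<Rightarrow> 'm \<Rightarrow> 'o \<Rightarrow> 'm \<Rightarrow> 'm \<Rightarrow> 'm
      \<Rightarrow> 'd \<Rightarrow> 'n \<Rightarrow> 'n \<Rightarrow> bool"
  where "entwined_module D A m \<eta> X \<psi> \<delta> \<epsilon> M \<mu> \<rho> \<longleftrightarrow>
    right_module D A m \<eta> M \<mu> \<and> \<rho> \<in> hom\<^bsub>D\<^esub> M (M \<odot>\<^bsub>D\<^esub> X) \<and>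
    \<rho> \<cdot>\<^bsub>D\<^esub> \<mu> = (\<mu> \<boxdot>\<^bsub>D\<^esub> Id X) \<cdot>\<^bsub>D\<^esub> (Id\<^bsub>D\<^esub> M \<boxdot>\<^bsub>D\<^esub> \<psi>) \<cdot>\<^bsub>D\<^esub> (\<rho> \<boxdot>\<^bsub>D\<^esub> Id A) \<and>
    (\<rho> \<boxdot>\<^bsub>D\<^esub> Id X) \<cdot>\<^bsub>D\<^esub> \<rho> = (\<mu> \<boxdot>\<^bsub>D\<^esub> Id (X \<otimes> X)) \<cdot>\<^bsub>D\<^esub> (Id\<^bsub>D\<^esub> M \<boxdot>\<^bsub>D\<^esub> \<delta>) \<cdot>\<^bsub>D\<^esub> \<rho> \<and>
    \<mu> \<cdot>\<^bsub>D\<^esub> (Id\<^bsub>D\<^esub> M \<boxdot>\<^bsub>D\<^esub> \<epsilon>) \<cdot>\<^bsub>D\<^esub> \<rho> = Id\<^bsub>D\<^esub> M"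

definition entwined_category ::
    "('d, 'n, 'o, 'm, 'y) actcat_scheme \<Rightarrow> 'o \<Rightarrow> 'm \<Rightarrow> 'm \<Rightarrow> 'o \<Rightarrow> 'm \<Rightarrow> 'm \<Rightarrow> 'm
      \<Rightarrow> ('d \<times> 'n \<times> 'n, ('d \<times> 'n \<times> 'n) \<times> 'n \<times> ('d \<times> 'n \<times> 'n)) cat"
  where "entwined_category D A m \<eta> X \<psi> \<delta> \<epsilon> = \<lparr>
    Ob = {(M, \<mu>, \<rho>). entwined_module D A m \<eta> X \<psi> \<delta> \<epsilon> M \<mu> \<rho>},
    Ar = {((M, \<mu>, \<rho>), f, (N, \<nu>, \<sigma>)) | M \<mu> \<rho> f N \<nu> \<sigma>.
      entwined_module D A m \<eta> X \<psi> \<delta> \<epsilon> M \<mu> \<rho> \<and> entwined_module D A m \<eta> X \<psi> \<delta> \<epsilon> N \<nu> \<sigma> \<and>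
      f \<in> hom\<^bsub>D\<^esub> M N \<and> right_linear D A \<mu> \<nu> f \<and>
      (f \<boxdot>\<^bsub>D\<^esub> Id X) \<cdot>\<^bsub>D\<^esub> \<rho> = \<sigma> \<cdot>\<^bsub>D\<^esub> f},
    Dom = (\<lambda>(P, f, Q). P),
    Cod = (\<lambda>(P, f, Q). Q),
    Idt = (\<lambda>(M, \<mu>, \<rho>). ((M, \<mu>, \<rho>), Id\<^bsub>D\<^esub> M, (M, \<mu>, \<rho>))),
    Cmp = (\<lambda>(_, g, Q) (P, f, _). (P, g \<cdot>\<^bsub>D\<^esub> f, Q)) \<rparr>"

definition wreath_mult :: "'o \<Rightarrow> 'm \<Rightarrow> 'o \<Rightarrow> 'm \<Rightarrow> 'm \<Rightarrow> 'o \<Rightarrow> 'm \<Rightarrow> 'm \<Rightarrow> 'm"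
  where "wreath_mult A m X \<psi> \<delta> Y b d =
    (Y \<lhd> m)
    \<cdot> (Y \<lhd> m \<rhd> A)
    \<cdot> (Y \<otimes> A \<otimes> A \<lhd> d \<rhd> A)
    \<cdot> (Y \<otimes> A \<lhd> \<psi> \<rhd> Y \<otimes> A)
    \<cdot> (Y \<otimes> A \<otimes> X \<lhd> d \<rhd> A \<otimes> Y \<otimes> A)
    \<cdot> (Y \<lhd> \<delta> \<rhd> Y \<otimes> A \<otimes> Y \<otimes> A)
    \<cdot> (b \<rhd> Y \<otimes> A \<otimes> Y \<otimes> A)"

definition wreath_unit :: "'o \<Rightarrow> 'm \<Rightarrow> 'm \<Rightarrow> 'm"
  where "wreath_unit Y b \<epsilon> = (Y \<lhd> \<epsilon>) \<cdot> b"

end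

end

theory Submission
  imports Defs
begin

text \<open>
  By the adjunction between \<open>X\<close> and \<open>Y\<close>, morphisms \<open>Z \<rightarrow> YA\<close> correspond to morphisms \<open>XZ \<rightarrow> A\<close>,
  and the multiplication of \<open>YA\<close> becomes a product \<open>g \<star> f\<close> of \<open>g : XW \<rightarrow> A\<close> and \<open>f : XZ \<rightarrow> A\<close>.
  An entwined module \<open>(M, \<mu>, \<rho>)\<close> lets every \<open>f : XZ \<rightarrow> A\<close> act as
  \<open>\<langle>f\<rangle> = \<mu> \<circ> Mf \<circ> \<rho>Z : MZ \<rightarrow> M\<close>, and the axioms give \<open>\<langle>f\<rangle> \<circ> \<langle>g\<rangle>Z = \<langle>g \<star> f\<rangle>\<close>;
  a \<open>YA\<close>-module \<open>\<nu>\<close> lets \<open>f\<close> act, with the same law, through the transpose of \<open>f\<close>.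
  Thus \<open>\<nu> = \<langle>dA\<rangle>\<close>.  Conversely \<open>\<mu>\<close> is the action of \<open>p = m \<circ> \<epsilon>A\<close> and \<open>\<rho>\<close> is the transpose
  of the action of \<open>q = \<eta> \<circ> d\<close>, and the entwined module axioms for them follow from the values of
  \<open>q \<star> p\<close>, \<open>p \<star> p\<close>, \<open>p \<star> q\<close> and \<open>q \<star> q\<close>.
\<close>

section \<open>Categories in terms of carriers, domains and codomains\<close>

context category
begin

text \<open>Splitting \<open>hom\<close> into carrier, domain and codomain lets the simplifier
  compute types bottom up. These forms are stated for any \<open>category\<close>, so that they also
  apply to \<open>D\<close> through the qualifier \<open>module\<close>.\<close>

lemma in_hom_iff: "f \<in> hom X Y \<longleftrightarrow> f \<in> Ar C \<and> Dom C f = X \<and> Cod C f = Y"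
  by (simp add: hom_def)

lemma Id_typing: "X \<in> Ob C \<Longrightarrow> Id X \<in> Ar C" "X \<in> Ob C \<Longrightarrow> Dom C (Id X) = X"
    "X \<in> Ob C \<Longrightarrow> Cod C (Id X) = X"
  using Id_hom by (auto simp: in_hom_iff)

lemma comp_typing:
  assumes "f \<in> Ar C" "g \<in> Ar C" "Dom C g = Cod C f"
  shows "g \<cdot> f \<in> Ar C" "Dom C (g \<cdot> f) = Dom C f" "Cod C (g \<cdot> f) = Cod C g"
  using comp_hom[of g "Cod C f" "Cod C g" f "Dom C f"] assms by (auto simp: in_hom_iff)

lemma comp_unit:
  assumes "f \<in> Ar C"
  shows "Dom C f = X \<Longrightarrow> f \<cdot> Id X = f" "Cod C f = X \<Longrightarrow> Id X \<cdot> f = f"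
  using comp_Id Id_comp assms by (auto simp: in_hom_iff)

lemma comp_assoc_Ar:
  assumes "f \<in> Ar C" "g \<in> Ar C" "h \<in> Ar C" "Dom C g = Cod C f" "Dom C h = Cod C g"
  shows "(h \<cdot> g) \<cdot> f = h \<cdot> (g \<cdot> f)"
  using comp_assoc assms by (auto simp: in_hom_iff)

end

section \<open>Calculus of the right action\<close>

context right_monoidal_action
begin

lemma act_typing:
  assumes "u \<in> Ar D" "f \<in> Ar C"
  shows "u \<boxdot>\<^bsub>D\<^esub> f \<in> Ar D" "Dom D (u \<boxdot>\<^bsub>D\<^esub> f) = Dom D u \<odot>\<^bsub>D\<^esub> Dom C f"
    "Cod D (u \<boxdot>\<^bsub>D\<^esub> f) = Cod D u \<odot>\<^bsub>D\<^esub> Cod C f"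
  using act_hom[of u "Dom D u" "Cod D u" f "Dom C f" "Cod C f"] assms
  by (auto simp: hom_iff module.in_hom_iff)

lemma act_comp_Ar:
  assumes "u \<in> Ar D" "u' \<in> Ar D" "Dom D u' = Cod D u" "f \<in> Ar C" "f' \<in> Ar C" "Dom C f' = Cod C f"
  shows "(u' \<cdot>\<^bsub>D\<^esub> u) \<boxdot>\<^bsub>D\<^esub> (f' \<cdot> f) = (u' \<boxdot>\<^bsub>D\<^esub> f') \<cdot>\<^bsub>D\<^esub> (u \<boxdot>\<^bsub>D\<^esub> f)"
  using act_comp[of u' "Cod D u" _ u _ f' "Cod C f"] assms
  by (auto simp: hom_iff module.in_hom_iff)

lemma act_comp_right:
  assumes "Z \<in> Ob C" "u \<in> Ar D" "u' \<in> Ar D" "Dom D u' = Cod D u"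
  shows "(u' \<cdot>\<^bsub>D\<^esub> u) \<boxdot>\<^bsub>D\<^esub> Id Z = (u' \<boxdot>\<^bsub>D\<^esub> Id Z) \<cdot>\<^bsub>D\<^esub> (u \<boxdot>\<^bsub>D\<^esub> Id Z)"
  using act_comp_Ar[of u u' "Id Z" "Id Z"] assms by (simp add: basics)

lemma act_comp_left:
  assumes "M \<in> Ob D" "f \<in> Ar C" "f' \<in> Ar C" "Dom C f' = Cod C f"
  shows "Id\<^bsub>D\<^esub> M \<boxdot>\<^bsub>D\<^esub> (f' \<cdot> f) = (Id\<^bsub>D\<^esub> M \<boxdot>\<^bsub>D\<^esub> f') \<cdot>\<^bsub>D\<^esub> (Id\<^bsub>D\<^esub> M \<boxdot>\<^bsub>D\<^esub> f)"
  using act_comp_Ar[of "Id\<^bsub>D\<^esub> M" "Id\<^bsub>D\<^esub> M" f f'] assms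
  by (simp add: module.Id_typing module.comp_unit)

text \<open>Bifunctoriality: both sides equal \<open>u \<boxdot> f\<close>. Neither side is a better
  normal form, so this law stays outside \<open>act_normal\<close> and each use of it is an explicit
  step.\<close>

lemma act_exchange:
  assumes "u \<in> Ar D" "Dom D u = M" "Cod D u = N" "f \<in> Ar C" "Dom C f = V" "Cod C f = W"
  shows "(Id\<^bsub>D\<^esub> N \<boxdot>\<^bsub>D\<^esub> f) \<cdot>\<^bsub>D\<^esub> (u \<boxdot>\<^bsub>D\<^esub> Id V) = (u \<boxdot>\<^bsub>D\<^esub> Id W) \<cdot>\<^bsub>D\<^esub> (Id\<^bsub>D\<^esub> M \<boxdot>\<^bsub>D\<^esub> f)"
proof -
  have "M \<in> Ob D" "N \<in> Ob D" "V \<in> Ob C" "W \<in> Ob C"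
    using assms module.Dom_Ob module.Cod_Ob Dom_Ob Cod_Ob by auto
  then show ?thesis
    using act_comp_Ar[of u "Id\<^bsub>D\<^esub> N" "Id V" f] act_comp_Ar[of "Id\<^bsub>D\<^esub> M" u f "Id W"] assms
    by (simp add: basics module.Id_typing module.comp_unit)
qed

text \<open>Strictness of the action, oriented so that iterated whiskerings collapse into one action
  by a tensor product.\<close>

lemma act_nested:
  "\<lbrakk>u \<in> Ar D; V \<in> Ob C; W \<in> Ob C\<rbrakk> \<Longrightarrow> (u \<boxdot>\<^bsub>D\<^esub> Id V) \<boxdot>\<^bsub>D\<^esub> Id W = u \<boxdot>\<^bsub>D\<^esub> Id (V \<otimes> W)"
  "\<lbrakk>M \<in> Ob D; f \<in> Ar C; W \<in> Ob C\<rbrakk>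
    \<Longrightarrow> (Id\<^bsub>D\<^esub> M \<boxdot>\<^bsub>D\<^esub> f) \<boxdot>\<^bsub>D\<^esub> Id W = Id\<^bsub>D\<^esub> M \<boxdot>\<^bsub>D\<^esub> (f \<rhd> W)"
  "\<lbrakk>M \<in> Ob D; V \<in> Ob C; f \<in> Ar C\<rbrakk>
    \<Longrightarrow> Id\<^bsub>D\<^esub> (M \<odot>\<^bsub>D\<^esub> V) \<boxdot>\<^bsub>D\<^esub> f = Id\<^bsub>D\<^esub> M \<boxdot>\<^bsub>D\<^esub> (V \<lhd> f)"
  using act_assoc_Ar[of "Id\<^bsub>D\<^esub> M" "Id V" f]
  by (simp_all add: act_assoc_Ar act_Id ar_id tensor_Id module.Id_typing)

lemmas act_basics = basics module.Id_typing module.comp_typing module.comp_unit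
  module.Dom_Ob module.Cod_Ob act_typing act_Ob act_Id act_assoc_Ob act_unit_Ob act_unit_Ar

lemmas act_normal = act_comp_left act_comp_right act_nested module.comp_assoc_Ar

end

section \<open>A cowreath whose object \<open>X\<close> is left adjoint to \<open>Y\<close>\<close>

locale cowreath_adjunction = strict_monoidal_category C
  for C :: "('o, 'm, 'x) moncat_scheme" (structure) +
  fixes A X Y :: 'o and m \<eta> \<psi> \<delta> \<epsilon> b d :: 'm
  assumes cowreath: "cowreath C A m \<eta> X \<psi> \<delta> \<epsilon>"
    and adjunction: "adjunction C X Y b d"
begin

lemma objects: "A \<in> Ob C" "X \<in> Ob C" "Y \<in> Ob C"
  using cowreath adjunction by (auto simp: cowreath_iff algebra_def adjunction_def)

lemma arrows:
  "m \<in> Ar C" "Dom C m = A \<otimes> A" "Cod C m = A" "\<eta> \<in> Ar C" "Dom C \<eta> = \<one>" "Cod C \<eta> = A"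
  "\<psi> \<in> Ar C" "Dom C \<psi> = X \<otimes> A" "Cod C \<psi> = A \<otimes> X"
  "\<delta> \<in> Ar C" "Dom C \<delta> = X" "Cod C \<delta> = A \<otimes> X \<otimes> X"
  "\<epsilon> \<in> Ar C" "Dom C \<epsilon> = X" "Cod C \<epsilon> = A"
  "b \<in> Ar C" "Dom C b = \<one>" "Cod C b = Y \<otimes> X"
  "d \<in> Ar C" "Dom C d = X \<otimes> Y" "Cod C d = \<one>"
  using cowreath adjunction
  by (auto simp: cowreath_iff algebra_def adjunction_def transfer_Ob_def hom_iff)

lemma mult_assoc: "m \<cdot> (m \<rhd> A) = m \<cdot> (A \<lhd> m)"
  and mult_unit: "m \<cdot> (\<eta> \<rhd> A) = Id A" "m \<cdot> (A \<lhd> \<eta>) = Id A"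
  and \<psi>_mult: "\<psi> \<cdot> (X \<lhd> m) = (m \<rhd> X) \<cdot> (A \<lhd> \<psi>) \<cdot> (\<psi> \<rhd> A)"
  and \<psi>_unit: "\<psi> \<cdot> (X \<lhd> \<eta>) = \<eta> \<rhd> X"
  and \<epsilon>_transfer: "m \<cdot> (A \<lhd> \<epsilon>) \<cdot> \<psi> = m \<cdot> (\<epsilon> \<rhd> A)"
  and counit_left: "(m \<rhd> X) \<cdot> (A \<lhd> \<epsilon> \<rhd> X) \<cdot> \<delta> = \<eta> \<rhd> X"
  and counit_right: "(m \<rhd> X) \<cdot> (A \<lhd> \<psi>) \<cdot> (A \<otimes> X \<lhd> \<epsilon>) \<cdot> \<delta> = \<eta> \<rhd> X"
  and snake: "(Y \<lhd> d) \<cdot> (b \<rhd> Y) = Id Y" "(d \<rhd> X) \<cdot> (X \<lhd> b) = Id X"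
  using cowreath adjunction
  by (auto simp: cowreath_iff algebra_def adjunction_def transfer_Ob_def)

lemmas typed = basics objects arrows
lemmas normal = dist_l dist_r idl ar_assoc

section \<open>Transposition along the adjunction\<close>

definition transpose :: "'o \<Rightarrow> 'm \<Rightarrow> 'm"
  where "transpose Z f = (Y \<lhd> f) \<cdot> (b \<rhd> Z)"

lemma transpose_typing:
  assumes "Z \<in> Ob C" "f \<in> Ar C" "Dom C f = X \<otimes> Z"
  shows "transpose Z f \<in> Ar C" "Dom C (transpose Z f) = Z" "Cod C (transpose Z f) = Y \<otimes> Cod C f"
  using assms by (simp_all add: transpose_def typed)

text \<open>Naturality in \<open>Z\<close>: \<open>b\<close> and \<open>u\<close> live on different
  tensor factors, so \<open>u\<close> slides past \<open>b\<close> and ends up under the whiskering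
  by \<open>Y\<close>.\<close>

lemma transpose_comp:
  assumes "f \<in> Ar C" "Dom C f = X \<otimes> Z" "u \<in> Ar C" "Dom C u = W" "Cod C u = Z"
  shows "transpose Z f \<cdot> u = transpose W (f \<cdot> (X \<lhd> u))"
proof -
  have o: "Z \<in> Ob C" "W \<in> Ob C" using assms Dom_Ob Cod_Ob by auto
  note t = typed assms o
  have "transpose Z f \<cdot> u = (Y \<lhd> f) \<cdot> ((b \<rhd> Z) \<cdot> (\<one> \<lhd> u))"
    by (simp add: transpose_def t normal)
  also have "(b \<rhd> Z) \<cdot> (\<one> \<lhd> u) = (Y \<otimes> X \<lhd> u) \<cdot> (b \<rhd> W)"
    using exch[of b u] by (simp add: t)
  finally show ?thesis by (simp add: transpose_def t normal)
qed

text \<open>Whiskering with \<open>X\<close> and applying \<open>d\<close> is the inverse of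
  transposition. Sliding \<open>f\<close> past \<open>d\<close> brings \<open>d\<close> next to
  \<open>b\<close>, and the second snake identity cancels them.\<close>

lemma untranspose_transpose:
  assumes "Z \<in> Ob C" "f \<in> Ar C" "Dom C f = X \<otimes> Z" "Cod C f = B"
  shows "(d \<rhd> B) \<cdot> (X \<lhd> transpose Z f) = f"
proof -
  have o: "B \<in> Ob C" using assms Cod_Ob by auto
  note t = typed assms o
  have "(d \<rhd> B) \<cdot> (X \<lhd> transpose Z f) = ((d \<rhd> B) \<cdot> (X \<otimes> Y \<lhd> f)) \<cdot> (X \<lhd> b \<rhd> Z)"
    by (simp add: transpose_def t normal)
  also have "(d \<rhd> B) \<cdot> (X \<otimes> Y \<lhd> f) = f \<cdot> (d \<rhd> X \<otimes> Z)"
    using exch[of d f] by (simp add: t)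
  also have "(f \<cdot> (d \<rhd> X \<otimes> Z)) \<cdot> (X \<lhd> b \<rhd> Z) = f \<cdot> (((d \<rhd> X) \<cdot> (X \<lhd> b)) \<rhd> Z)"
    by (simp add: t normal)
  finally show ?thesis by (simp add: snake t)
qed

text \<open>The first snake identity, whiskered with \<open>B\<close>. Thus \<open>dA\<close> is the
  morphism that corresponds to the identity of \<open>YA\<close>.\<close>

lemma transpose_counit: "transpose (Y \<otimes> B) (d \<rhd> B) = Id (Y \<otimes> B)" if "B \<in> Ob C"
proof -
  have "transpose (Y \<otimes> B) (d \<rhd> B) = ((Y \<lhd> d) \<cdot> (b \<rhd> Y)) \<rhd> B"
    by (simp add: transpose_def typed that normal)
  then show ?thesis by (simp add: snake typed that)
qed

section \<open>Multiplication of the wreath product in transposed form\<close>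

text \<open>The product of \<open>YA\<close>, transported along \<open>hom(Z, YA) \<cong> hom(XZ, A)\<close>.\<close>

definition star :: "'o \<Rightarrow> 'o \<Rightarrow> 'm \<Rightarrow> 'm \<Rightarrow> 'm"
  where "star W Z g f = m \<cdot> (m \<rhd> A) \<cdot> (A \<otimes> A \<lhd> f) \<cdot> (A \<lhd> \<psi> \<rhd> Z) \<cdot> (A \<otimes> X \<lhd> g \<rhd> Z)
    \<cdot> (\<delta> \<rhd> W \<otimes> Z)"

lemma star_typing:
  assumes "W \<in> Ob C" "Z \<in> Ob C" "g \<in> Ar C" "Dom C g = X \<otimes> W" "Cod C g = A"
    "f \<in> Ar C" "Dom C f = X \<otimes> Z" "Cod C f = A"
  shows "star W Z g f \<in> Ar C" "Dom C (star W Z g f) = X \<otimes> W \<otimes> Z" "Cod C (star W Z g f) = A"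
  using assms by (simp_all add: star_def typed)

abbreviation "wmult \<equiv> wreath_mult C A m X \<psi> \<delta> Y b d"

text \<open>After the initial \<open>b\<close>, every factor of the multiplication is whiskered by
  \<open>Y\<close> on the left. What stands under that whiskering is \<open>star\<close> of two
  copies of \<open>dA\<close>.\<close>

lemma wreath_mult_transpose:
  "wmult = transpose (Y \<otimes> A \<otimes> Y \<otimes> A) (star (Y \<otimes> A) (Y \<otimes> A) (d \<rhd> A) (d \<rhd> A))"
  by (simp add: wreath_mult_def transpose_def star_def typed normal)

text \<open>This is what makes \<open>star\<close> the product of \<open>YA\<close>. By naturality
  the two transposes slide past \<delta>. The one of \<open>g\<close> then meets the first counit
  \<open>dA\<close>, while the one of \<open>f\<close> passes this counit and \<psi> before it meets
  the second. Each meeting is an untransposition and returns \<open>g\<close> or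
  \<open>f\<close>.\<close>

lemma wreath_mult_tensor:
  assumes "W \<in> Ob C" "Z \<in> Ob C" "g \<in> Ar C" "Dom C g = X \<otimes> W" "Cod C g = A"
    "f \<in> Ar C" "Dom C f = X \<otimes> Z" "Cod C f = A"
  shows "wmult \<cdot> (transpose W g \<boxtimes> transpose Z f) = transpose (W \<otimes> Z) (star W Z g f)"
proof -
  let ?f = "transpose Z f" and ?g = "transpose W g"
  note t = typed assms transpose_typing
  have split: "?g \<boxtimes> ?f = (Y \<otimes> A \<lhd> ?f) \<cdot> (?g \<rhd> Z)"
    using exch[of ?g ?f] by (simp add: t)
  have "star (Y \<otimes> A) (Y \<otimes> A) (d \<rhd> A) (d \<rhd> A) \<cdot> (X \<lhd> ?g \<boxtimes> ?f)
    = m \<cdot> (m \<rhd> A) \<cdot> (A \<otimes> A \<lhd> d \<rhd> A) \<cdot> (A \<lhd> \<psi> \<rhd> Y \<otimes> A) \<cdot> (A \<otimes> X \<lhd> d \<rhd> A \<otimes> Y \<otimes> A)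
      \<cdot> ((\<delta> \<rhd> Y \<otimes> A \<otimes> Y \<otimes> A) \<cdot> (X \<lhd> ?g \<boxtimes> ?f))"
    by (simp add: star_def t normal)
  also have "(\<delta> \<rhd> Y \<otimes> A \<otimes> Y \<otimes> A) \<cdot> (X \<lhd> ?g \<boxtimes> ?f) = (A \<otimes> X \<otimes> X \<lhd> ?g \<boxtimes> ?f) \<cdot> (\<delta> \<rhd> W \<otimes> Z)"
    using exch[of \<delta> "?g \<boxtimes> ?f"] by (simp add: t)
  also have "m \<cdot> (m \<rhd> A) \<cdot> (A \<otimes> A \<lhd> d \<rhd> A) \<cdot> (A \<lhd> \<psi> \<rhd> Y \<otimes> A) \<cdot> (A \<otimes> X \<lhd> d \<rhd> A \<otimes> Y \<otimes> A)
      \<cdot> ((A \<otimes> X \<otimes> X \<lhd> ?g \<boxtimes> ?f) \<cdot> (\<delta> \<rhd> W \<otimes> Z))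
    = m \<cdot> (m \<rhd> A) \<cdot> (A \<otimes> A \<lhd> d \<rhd> A) \<cdot> (A \<lhd> \<psi> \<rhd> Y \<otimes> A)
      \<cdot> (A \<otimes> X \<lhd> (((d \<rhd> A) \<rhd> Y \<otimes> A) \<cdot> (X \<otimes> Y \<otimes> A \<lhd> ?f)))
      \<cdot> (A \<otimes> X \<otimes> X \<lhd> ?g \<rhd> Z) \<cdot> (\<delta> \<rhd> W \<otimes> Z)"
    by (simp add: split t normal)
  also have "((d \<rhd> A) \<rhd> Y \<otimes> A) \<cdot> (X \<otimes> Y \<otimes> A \<lhd> ?f) = (A \<lhd> ?f) \<cdot> (d \<rhd> A \<otimes> Z)"
    using exch[of "d \<rhd> A" ?f] by (simp add: t idl)
  also have "m \<cdot> (m \<rhd> A) \<cdot> (A \<otimes> A \<lhd> d \<rhd> A) \<cdot> (A \<lhd> \<psi> \<rhd> Y \<otimes> A)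
      \<cdot> (A \<otimes> X \<lhd> ((A \<lhd> ?f) \<cdot> (d \<rhd> A \<otimes> Z))) \<cdot> (A \<otimes> X \<otimes> X \<lhd> ?g \<rhd> Z) \<cdot> (\<delta> \<rhd> W \<otimes> Z)
    = m \<cdot> (m \<rhd> A) \<cdot> (A \<otimes> A \<lhd> d \<rhd> A) \<cdot> (A \<lhd> ((\<psi> \<rhd> Y \<otimes> A) \<cdot> (X \<otimes> A \<lhd> ?f)))
      \<cdot> (A \<otimes> X \<lhd> ((d \<rhd> A) \<cdot> (X \<lhd> ?g)) \<rhd> Z) \<cdot> (\<delta> \<rhd> W \<otimes> Z)"
    by (simp add: t normal)
  also have "(\<psi> \<rhd> Y \<otimes> A) \<cdot> (X \<otimes> A \<lhd> ?f) = (A \<otimes> X \<lhd> ?f) \<cdot> (\<psi> \<rhd> Z)"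
    using exch[of \<psi> ?f] by (simp add: t)
  also have "(d \<rhd> A) \<cdot> (X \<lhd> ?g) = g"
    by (rule untranspose_transpose) (simp_all add: assms)
  also have "m \<cdot> (m \<rhd> A) \<cdot> (A \<otimes> A \<lhd> d \<rhd> A) \<cdot> (A \<lhd> ((A \<otimes> X \<lhd> ?f) \<cdot> (\<psi> \<rhd> Z)))
      \<cdot> (A \<otimes> X \<lhd> g \<rhd> Z) \<cdot> (\<delta> \<rhd> W \<otimes> Z)
    = m \<cdot> (m \<rhd> A) \<cdot> (A \<otimes> A \<lhd> ((d \<rhd> A) \<cdot> (X \<lhd> ?f))) \<cdot> (A \<lhd> \<psi> \<rhd> Z)
      \<cdot> (A \<otimes> X \<lhd> g \<rhd> Z) \<cdot> (\<delta> \<rhd> W \<otimes> Z)"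
    by (simp add: t normal)
  also have "(d \<rhd> A) \<cdot> (X \<lhd> ?f) = f"
    by (rule untranspose_transpose) (simp_all add: assms)
  finally have "star (Y \<otimes> A) (Y \<otimes> A) (d \<rhd> A) (d \<rhd> A) \<cdot> (X \<lhd> ?g \<boxtimes> ?f) = star W Z g f"
    by (simp add: star_def)
  then show ?thesis
    unfolding wreath_mult_transpose
    by (subst transpose_comp) (simp_all add: t star_typing)
qed

section \<open>Products of the canonical morphisms \<open>p\<close> and \<open>q\<close>\<close>

text \<open>\<open>p\<close> and \<open>q\<close> are the transposes of the canonical morphisms \<open>A \<rightarrow> YA\<close> and \<open>Y \<rightarrow> YA\<close>.\<close>

definition p where "p = m \<cdot> (\<epsilon> \<rhd> A)"
definition q where "q = \<eta> \<cdot> d"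

lemma p_q_typing:
  "p \<in> Ar C" "Dom C p = X \<otimes> A" "Cod C p = A" "q \<in> Ar C" "Dom C q = X \<otimes> Y" "Cod C q = A"
  by (simp_all add: p_def q_def typed)

text \<open>Multiplicativity of \<psi> splits \<psi> over the \<open>m\<close> inside
  \<open>p\<close>. The copy of \<psi> that meets \<epsilon> collapses to \<eta> by
  \<open>counit_right\<close>, and the other copy is the result.\<close>

lemma \<psi>_p: "(m \<rhd> X) \<cdot> (A \<lhd> (\<psi> \<cdot> (X \<lhd> p))) \<cdot> (\<delta> \<rhd> A) = \<psi>"
proof -
  have "(m \<rhd> X) \<cdot> (A \<lhd> (\<psi> \<cdot> (X \<lhd> p))) \<cdot> (\<delta> \<rhd> A)
    = (m \<rhd> X) \<cdot> (A \<lhd> (\<psi> \<cdot> (X \<lhd> m))) \<cdot> (A \<otimes> X \<lhd> \<epsilon> \<rhd> A) \<cdot> (\<delta> \<rhd> A)"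
    by (simp add: p_def typed normal)
  also have "\<dots> = ((m \<cdot> (A \<lhd> m)) \<rhd> X) \<cdot> (A \<otimes> A \<lhd> \<psi>) \<cdot> (A \<lhd> \<psi> \<rhd> A)
      \<cdot> (A \<otimes> X \<lhd> \<epsilon> \<rhd> A) \<cdot> (\<delta> \<rhd> A)"
    unfolding \<psi>_mult by (simp add: typed normal)
  also have "\<dots> = (m \<rhd> X) \<cdot> ((m \<rhd> A \<otimes> X) \<cdot> (A \<otimes> A \<lhd> \<psi>)) \<cdot> (A \<lhd> \<psi> \<rhd> A)
      \<cdot> (A \<otimes> X \<lhd> \<epsilon> \<rhd> A) \<cdot> (\<delta> \<rhd> A)"
    unfolding mult_assoc[symmetric] by (simp add: typed normal)
  also have "(m \<rhd> A \<otimes> X) \<cdot> (A \<otimes> A \<lhd> \<psi>) = (A \<lhd> \<psi>) \<cdot> (m \<rhd> X \<otimes> A)"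
    using exch[of m \<psi>] by (simp add: typed)
  also have "(m \<rhd> X) \<cdot> ((A \<lhd> \<psi>) \<cdot> (m \<rhd> X \<otimes> A)) \<cdot> (A \<lhd> \<psi> \<rhd> A) \<cdot> (A \<otimes> X \<lhd> \<epsilon> \<rhd> A) \<cdot> (\<delta> \<rhd> A)
    = (m \<rhd> X) \<cdot> (A \<lhd> \<psi>) \<cdot> (((m \<rhd> X) \<cdot> (A \<lhd> \<psi>) \<cdot> (A \<otimes> X \<lhd> \<epsilon>) \<cdot> \<delta>) \<rhd> A)"
    by (simp add: typed normal)
  also have "\<dots> = (m \<rhd> X) \<cdot> ((A \<lhd> \<psi>) \<cdot> (\<eta> \<rhd> X \<otimes> A))"
    unfolding counit_right by (simp add: typed normal)
  also have "(A \<lhd> \<psi>) \<cdot> (\<eta> \<rhd> X \<otimes> A) = (\<eta> \<rhd> A \<otimes> X) \<cdot> \<psi>"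
    using exch[of \<eta> \<psi>] by (simp add: typed)
  also have "(m \<rhd> X) \<cdot> (\<eta> \<rhd> A \<otimes> X) \<cdot> \<psi> = ((m \<cdot> (\<eta> \<rhd> A)) \<rhd> X) \<cdot> \<psi>"
    by (simp add: typed normal)
  finally show ?thesis by (simp add: mult_unit typed)
qed

text \<open>The transfer condition on \<epsilon> gives a second expression for \<open>p\<close>,
  namely \<psi> followed by \<open>A \<lhd> \<epsilon>\<close> and \<open>m\<close>. In this form
  \<open>A \<lhd> \<epsilon>\<close> can be moved past a multiplication, which exposes the left side
  of \<open>\<psi>_p\<close>.\<close>

lemma p_p: "m \<cdot> (A \<lhd> (p \<cdot> (X \<lhd> p))) \<cdot> (\<delta> \<rhd> A) = p"
proof -
  have p_alt: "p = m \<cdot> (A \<lhd> \<epsilon>) \<cdot> \<psi>" by (simp add: p_def \<epsilon>_transfer)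
  have "m \<cdot> (A \<lhd> (p \<cdot> (X \<lhd> p))) \<cdot> (\<delta> \<rhd> A)
    = m \<cdot> (A \<lhd> ((m \<cdot> (A \<lhd> \<epsilon>) \<cdot> \<psi>) \<cdot> (X \<lhd> p))) \<cdot> (\<delta> \<rhd> A)"
    by (simp only: p_alt[symmetric])
  also have "\<dots> = (m \<cdot> (A \<lhd> m)) \<cdot> (A \<otimes> A \<lhd> \<epsilon>) \<cdot> (A \<lhd> (\<psi> \<cdot> (X \<lhd> p))) \<cdot> (\<delta> \<rhd> A)"
    by (simp add: typed p_q_typing normal)
  also have "\<dots> = m \<cdot> ((m \<rhd> A) \<cdot> (A \<otimes> A \<lhd> \<epsilon>)) \<cdot> (A \<lhd> (\<psi> \<cdot> (X \<lhd> p))) \<cdot> (\<delta> \<rhd> A)"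
    unfolding mult_assoc[symmetric] by (simp add: typed p_q_typing normal)
  also have "(m \<rhd> A) \<cdot> (A \<otimes> A \<lhd> \<epsilon>) = (A \<lhd> \<epsilon>) \<cdot> (m \<rhd> X)"
    using exch[of m \<epsilon>] by (simp add: typed)
  also have "m \<cdot> ((A \<lhd> \<epsilon>) \<cdot> (m \<rhd> X)) \<cdot> (A \<lhd> (\<psi> \<cdot> (X \<lhd> p))) \<cdot> (\<delta> \<rhd> A)
    = m \<cdot> (A \<lhd> \<epsilon>) \<cdot> ((m \<rhd> X) \<cdot> (A \<lhd> (\<psi> \<cdot> (X \<lhd> p))) \<cdot> (\<delta> \<rhd> A))"
    by (simp add: typed p_q_typing normal)
  finally show ?thesis unfolding \<psi>_p p_alt[symmetric] .
qed

text \<open>The unit inside \<open>q\<close> slides past the inner \<open>m\<close> and is absorbed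
  by the outer one; only \<open>d\<close> survives.\<close>

lemma mult_mult_q: "m \<cdot> (m \<rhd> A) \<cdot> (A \<otimes> A \<lhd> q) = m \<cdot> (A \<otimes> A \<lhd> d)"
proof -
  have "m \<cdot> (m \<rhd> A) \<cdot> (A \<otimes> A \<lhd> q) = m \<cdot> ((m \<rhd> A) \<cdot> (A \<otimes> A \<lhd> \<eta>)) \<cdot> (A \<otimes> A \<lhd> d)"
    by (simp add: q_def typed normal)
  also have "(m \<rhd> A) \<cdot> (A \<otimes> A \<lhd> \<eta>) = (A \<lhd> \<eta>) \<cdot> m"
    using exch[of m \<eta>] by (simp add: typed)
  also have "m \<cdot> ((A \<lhd> \<eta>) \<cdot> m) \<cdot> (A \<otimes> A \<lhd> d) = (m \<cdot> (A \<lhd> \<eta>)) \<cdot> m \<cdot> (A \<otimes> A \<lhd> d)"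
    by (simp add: typed normal)
  finally show ?thesis by (simp add: mult_unit typed)
qed

lemma \<psi>_q: "\<psi> \<cdot> (X \<lhd> q) = (\<eta> \<rhd> X) \<cdot> (X \<lhd> d)"
proof -
  have "\<psi> \<cdot> (X \<lhd> q) = (\<psi> \<cdot> (X \<lhd> \<eta>)) \<cdot> (X \<lhd> d)"
    by (simp add: q_def typed normal)
  then show ?thesis by (simp add: \<psi>_unit)
qed

text \<open>Since \<psi> passes the unit inside \<open>q\<close>, that unit cancels. Moving
  \<open>d\<close> past \<epsilon> then leaves \<epsilon> composed with \<delta>, which
  \<open>counit_left\<close> reduces to \<eta>. The value corresponds to the identity of
  \<open>YA\<close>, so every \<open>YA\<close>-action is recovered from the actions of
  \<open>q\<close> and \<open>p\<close>.\<close>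

lemma star_q_p: "star Y A q p = d \<rhd> A"
proof -
  have "star Y A q p = m \<cdot> (m \<rhd> A) \<cdot> (A \<otimes> A \<lhd> p) \<cdot> (A \<lhd> (\<psi> \<cdot> (X \<lhd> q)) \<rhd> A) \<cdot> (\<delta> \<rhd> Y \<otimes> A)"
    by (simp add: star_def typed p_q_typing normal)
  also have "\<dots> = m \<cdot> (m \<rhd> A) \<cdot> (A \<lhd> ((A \<lhd> p) \<cdot> (\<eta> \<rhd> X \<otimes> A))) \<cdot> (A \<otimes> X \<lhd> d \<rhd> A) \<cdot> (\<delta> \<rhd> Y \<otimes> A)"
    unfolding \<psi>_q by (simp add: typed p_q_typing normal)
  also have "(A \<lhd> p) \<cdot> (\<eta> \<rhd> X \<otimes> A) = (\<eta> \<rhd> A) \<cdot> p"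
    using exch[of \<eta> p] by (simp add: typed p_q_typing)
  also have "m \<cdot> (m \<rhd> A) \<cdot> (A \<lhd> ((\<eta> \<rhd> A) \<cdot> p)) \<cdot> (A \<otimes> X \<lhd> d \<rhd> A) \<cdot> (\<delta> \<rhd> Y \<otimes> A)
    = m \<cdot> ((m \<cdot> (A \<lhd> \<eta>)) \<rhd> A) \<cdot> (A \<lhd> p) \<cdot> (A \<otimes> X \<lhd> d \<rhd> A) \<cdot> (\<delta> \<rhd> Y \<otimes> A)"
    by (simp add: typed p_q_typing normal)
  also have "\<dots> = (m \<cdot> (A \<lhd> m)) \<cdot> (A \<lhd> ((\<epsilon> \<rhd> A) \<cdot> (X \<lhd> d \<rhd> A))) \<cdot> (\<delta> \<rhd> Y \<otimes> A)"
    unfolding mult_unit by (simp add: p_def typed normal)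
  also have "(\<epsilon> \<rhd> A) \<cdot> (X \<lhd> d \<rhd> A) = (A \<lhd> d \<rhd> A) \<cdot> (\<epsilon> \<rhd> X \<otimes> Y \<otimes> A)"
    using exch[of \<epsilon> "d \<rhd> A"] by (simp add: typed)
  also have "(m \<cdot> (A \<lhd> m)) \<cdot> (A \<lhd> ((A \<lhd> d \<rhd> A) \<cdot> (\<epsilon> \<rhd> X \<otimes> Y \<otimes> A))) \<cdot> (\<delta> \<rhd> Y \<otimes> A)
    = m \<cdot> ((m \<rhd> A) \<cdot> (A \<otimes> A \<lhd> d \<rhd> A)) \<cdot> (A \<lhd> \<epsilon> \<rhd> X \<otimes> Y \<otimes> A) \<cdot> (\<delta> \<rhd> Y \<otimes> A)"
    unfolding mult_assoc[symmetric] by (simp add: typed normal)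
  also have "(m \<rhd> A) \<cdot> (A \<otimes> A \<lhd> d \<rhd> A) = (A \<lhd> d \<rhd> A) \<cdot> (m \<rhd> X \<otimes> Y \<otimes> A)"
    using exch[of m "d \<rhd> A"] by (simp add: typed)
  also have "m \<cdot> ((A \<lhd> d \<rhd> A) \<cdot> (m \<rhd> X \<otimes> Y \<otimes> A)) \<cdot> (A \<lhd> \<epsilon> \<rhd> X \<otimes> Y \<otimes> A) \<cdot> (\<delta> \<rhd> Y \<otimes> A)
    = m \<cdot> (A \<lhd> d \<rhd> A) \<cdot> (((m \<rhd> X) \<cdot> (A \<lhd> \<epsilon> \<rhd> X) \<cdot> \<delta>) \<rhd> Y \<otimes> A)"
    by (simp add: typed normal)
  also have "\<dots> = m \<cdot> ((A \<lhd> d \<rhd> A) \<cdot> (\<eta> \<rhd> X \<otimes> Y \<otimes> A))"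
    unfolding counit_left by (simp add: typed normal)
  also have "(A \<lhd> d \<rhd> A) \<cdot> (\<eta> \<rhd> X \<otimes> Y \<otimes> A) = (\<eta> \<rhd> A) \<cdot> (d \<rhd> A)"
    using exch[of \<eta> "d \<rhd> A"] by (simp add: typed)
  also have "m \<cdot> (\<eta> \<rhd> A) \<cdot> (d \<rhd> A) = (m \<cdot> (\<eta> \<rhd> A)) \<cdot> (d \<rhd> A)"
    by (simp add: typed normal)
  finally show ?thesis by (simp add: mult_unit typed)
qed

text \<open>In terms of \<open>YA\<close>, the canonical morphism from \<open>A\<close> is
  multiplicative. The first two factors are regrouped until they form \<open>p_p\<close>; the
  remaining \<open>A\<close> is multiplied on at the end.\<close>

lemma star_p_p: "star A A p p = p \<cdot> (X \<lhd> m)"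
proof -
  have p_alt: "m \<cdot> (A \<lhd> \<epsilon>) \<cdot> \<psi> = p" by (simp add: p_def \<epsilon>_transfer)
  have "star A A p p = (m \<cdot> (m \<rhd> A)) \<cdot> (A \<otimes> A \<lhd> p) \<cdot> (A \<lhd> (\<psi> \<cdot> (X \<lhd> p)) \<rhd> A) \<cdot> (\<delta> \<rhd> A \<otimes> A)"
    by (simp add: star_def typed p_q_typing normal)
  also have "\<dots> = m \<cdot> (A \<lhd> ((m \<cdot> (A \<lhd> m)) \<cdot> (A \<lhd> \<epsilon> \<rhd> A) \<cdot> ((\<psi> \<cdot> (X \<lhd> p)) \<rhd> A))) \<cdot> (\<delta> \<rhd> A \<otimes> A)"
    unfolding mult_assoc by (simp add: p_def typed normal)
  \<comment> \<open>Associativity is used in both directions in order to put the \<epsilon> of the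
    second \<open>p\<close> directly after \<psi>, where the alternative form of \<open>p\<close>
    applies.\<close>
  also have "\<dots> = m \<cdot> (A \<lhd> ((m \<cdot> (m \<rhd> A)) \<cdot> (A \<lhd> \<epsilon> \<rhd> A) \<cdot> ((\<psi> \<cdot> (X \<lhd> p)) \<rhd> A))) \<cdot> (\<delta> \<rhd> A \<otimes> A)"
    unfolding mult_assoc ..
  also have "\<dots> = (m \<cdot> (A \<lhd> m)) \<cdot> (A \<lhd> ((m \<cdot> (A \<lhd> \<epsilon>) \<cdot> \<psi>) \<cdot> (X \<lhd> p)) \<rhd> A) \<cdot> (\<delta> \<rhd> A \<otimes> A)"
    by (simp add: typed p_q_typing normal)
  also have "\<dots> = m \<cdot> ((m \<cdot> (A \<lhd> (p \<cdot> (X \<lhd> p))) \<cdot> (\<delta> \<rhd> A)) \<rhd> A)"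
    unfolding mult_assoc[symmetric] p_alt by (simp add: typed p_q_typing normal)
  also have "\<dots> = (m \<cdot> (m \<rhd> A)) \<cdot> (\<epsilon> \<rhd> A \<otimes> A)"
    unfolding p_p by (simp add: p_def typed normal)
  also have "\<dots> = m \<cdot> ((A \<lhd> m) \<cdot> (\<epsilon> \<rhd> A \<otimes> A))"
    unfolding mult_assoc by (simp add: typed normal)
  also have "(A \<lhd> m) \<cdot> (\<epsilon> \<rhd> A \<otimes> A) = (\<epsilon> \<rhd> A) \<cdot> (X \<lhd> m)"
    using exch[of \<epsilon> m] by (simp add: typed)
  finally show ?thesis by (simp add: p_def typed normal)
qed

text \<open>The order of factors opposite to \<open>star_q_p\<close>, in which \<psi> remains. The
  unit of \<open>q\<close> is absorbed by \<open>mult_mult_q\<close>, and once \<open>d\<close> is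
  moved to the left, \<open>\<psi>_p\<close> removes \<delta> and \<open>p\<close>.\<close>

lemma star_p_q: "star A Y p q = (A \<lhd> d) \<cdot> (\<psi> \<rhd> Y)"
proof -
  have "star A Y p q = (m \<cdot> (m \<rhd> A) \<cdot> (A \<otimes> A \<lhd> q)) \<cdot> (A \<lhd> (\<psi> \<cdot> (X \<lhd> p)) \<rhd> Y) \<cdot> (\<delta> \<rhd> A \<otimes> Y)"
    by (simp add: star_def typed p_q_typing normal)
  also have "\<dots> = (m \<cdot> (A \<otimes> A \<lhd> d)) \<cdot> (A \<lhd> (\<psi> \<cdot> (X \<lhd> p)) \<rhd> Y) \<cdot> (\<delta> \<rhd> A \<otimes> Y)"
    unfolding mult_mult_q ..
  also have "m \<cdot> (A \<otimes> A \<lhd> d) = (A \<lhd> d) \<cdot> (m \<rhd> X \<otimes> Y)"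
    using exch[of m d] by (simp add: typed)
  also have "((A \<lhd> d) \<cdot> (m \<rhd> X \<otimes> Y)) \<cdot> (A \<lhd> (\<psi> \<cdot> (X \<lhd> p)) \<rhd> Y) \<cdot> (\<delta> \<rhd> A \<otimes> Y)
    = (A \<lhd> d) \<cdot> (((m \<rhd> X) \<cdot> (A \<lhd> (\<psi> \<cdot> (X \<lhd> p))) \<cdot> (\<delta> \<rhd> A)) \<rhd> Y)"
    by (simp add: typed p_q_typing normal)
  finally show ?thesis unfolding \<psi>_p .
qed

text \<open>Both units disappear, one through \<psi> and one through the multiplications. What
  remains is \<delta> with its two copies of \<open>X\<close> evaluated by \<open>d\<close>; the
  \<open>A\<close>-component of \<delta> is the result.\<close>

lemma star_q_q: "star Y Y q q = (A \<lhd> d) \<cdot> (A \<otimes> X \<lhd> d \<rhd> Y) \<cdot> (\<delta> \<rhd> Y \<otimes> Y)"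
proof -
  have "star Y Y q q = (m \<cdot> (m \<rhd> A) \<cdot> (A \<otimes> A \<lhd> q)) \<cdot> (A \<lhd> (\<psi> \<cdot> (X \<lhd> q)) \<rhd> Y) \<cdot> (\<delta> \<rhd> Y \<otimes> Y)"
    by (simp add: star_def typed p_q_typing normal)
  also have "\<dots> = m \<cdot> (A \<lhd> ((A \<lhd> d) \<cdot> (\<eta> \<rhd> X \<otimes> Y))) \<cdot> (A \<otimes> X \<lhd> d \<rhd> Y) \<cdot> (\<delta> \<rhd> Y \<otimes> Y)"
    unfolding mult_mult_q \<psi>_q by (simp add: typed normal)
  also have "(A \<lhd> d) \<cdot> (\<eta> \<rhd> X \<otimes> Y) = \<eta> \<cdot> d"
    using exch[of \<eta> d] by (simp add: typed)
  also have "m \<cdot> (A \<lhd> (\<eta> \<cdot> d)) \<cdot> (A \<otimes> X \<lhd> d \<rhd> Y) \<cdot> (\<delta> \<rhd> Y \<otimes> Y)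
    = (m \<cdot> (A \<lhd> \<eta>)) \<cdot> (A \<lhd> d) \<cdot> (A \<otimes> X \<lhd> d \<rhd> Y) \<cdot> (\<delta> \<rhd> Y \<otimes> Y)"
    by (simp add: typed normal)
  finally show ?thesis by (simp add: mult_unit typed)
qed

text \<open>The form of \<open>star_p_q\<close> needed for the entwining axiom: the argument
  \<open>Y\<close> is traded for an output \<open>X\<close> by means of \<open>b\<close>. The added
  \<open>b\<close> slides past \<psi> to the \<open>d\<close> of \<open>star_p_q\<close> and cancels
  with it by a snake identity.\<close>

lemma transpose_star_p_q:
  "(transpose (A \<otimes> Y) (star A Y p q) \<rhd> X) \<cdot> (A \<lhd> b) = (Y \<lhd> \<psi>) \<cdot> (b \<rhd> A)"
proof -
  have "(transpose (A \<otimes> Y) (star A Y p q) \<rhd> X) \<cdot> (A \<lhd> b)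
    = (Y \<otimes> A \<lhd> d \<rhd> X) \<cdot> (Y \<lhd> \<psi> \<rhd> Y \<otimes> X) \<cdot> ((b \<rhd> A \<otimes> Y \<otimes> X) \<cdot> (A \<lhd> b))"
    by (simp add: star_p_q transpose_def typed normal)
  also have "(b \<rhd> A \<otimes> Y \<otimes> X) \<cdot> (A \<lhd> b) = (Y \<otimes> X \<otimes> A \<lhd> b) \<cdot> (b \<rhd> A)"
    using exch[of b "A \<lhd> b"] by (simp add: typed normal)
  also have "(Y \<otimes> A \<lhd> d \<rhd> X) \<cdot> (Y \<lhd> \<psi> \<rhd> Y \<otimes> X) \<cdot> (Y \<otimes> X \<otimes> A \<lhd> b) \<cdot> (b \<rhd> A)
    = (Y \<otimes> A \<lhd> d \<rhd> X) \<cdot> (Y \<lhd> ((\<psi> \<rhd> Y \<otimes> X) \<cdot> (X \<otimes> A \<lhd> b))) \<cdot> (b \<rhd> A)"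
    by (simp add: typed normal)
  also have "(\<psi> \<rhd> Y \<otimes> X) \<cdot> (X \<otimes> A \<lhd> b) = (A \<otimes> X \<lhd> b) \<cdot> \<psi>"
    using exch[of \<psi> b] by (simp add: typed)
  also have "(Y \<otimes> A \<lhd> d \<rhd> X) \<cdot> (Y \<lhd> ((A \<otimes> X \<lhd> b) \<cdot> \<psi>)) \<cdot> (b \<rhd> A)
    = (Y \<otimes> A \<lhd> ((d \<rhd> X) \<cdot> (X \<lhd> b))) \<cdot> (Y \<lhd> \<psi>) \<cdot> (b \<rhd> A)"
    by (simp add: typed normal)
  finally show ?thesis by (simp add: snake typed)
qed

text \<open>The form of \<open>star_q_q\<close> needed for coassociativity. Both arguments
  \<open>Y\<close> are traded for outputs \<open>X\<close>; the nested copies of \<open>b\<close>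
  slide past \<delta>, and each cancels one \<open>d\<close> by a snake identity.\<close>

lemma transpose_star_q_q:
  "(transpose (Y \<otimes> Y) (star Y Y q q) \<rhd> X \<otimes> X) \<cdot> (Y \<lhd> b \<rhd> X) \<cdot> b = (Y \<lhd> \<delta>) \<cdot> b"
proof -
  have "(transpose (Y \<otimes> Y) (star Y Y q q) \<rhd> X \<otimes> X) \<cdot> (Y \<lhd> b \<rhd> X) \<cdot> b
    = (Y \<otimes> A \<lhd> d \<rhd> X \<otimes> X) \<cdot> (Y \<otimes> A \<otimes> X \<lhd> d \<rhd> Y \<otimes> X \<otimes> X) \<cdot> (Y \<lhd> \<delta> \<rhd> Y \<otimes> Y \<otimes> X \<otimes> X)
      \<cdot> ((b \<rhd> Y \<otimes> Y \<otimes> X \<otimes> X) \<cdot> ((Y \<lhd> b \<rhd> X) \<cdot> b))"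
    by (simp add: star_q_q transpose_def typed normal)
  also have "(b \<rhd> Y \<otimes> Y \<otimes> X \<otimes> X) \<cdot> ((Y \<lhd> b \<rhd> X) \<cdot> b)
      = (Y \<otimes> X \<lhd> ((Y \<lhd> b \<rhd> X) \<cdot> b)) \<cdot> b"
    using exch[of b "(Y \<lhd> b \<rhd> X) \<cdot> b"] by (simp add: typed)
  also have "(Y \<otimes> A \<lhd> d \<rhd> X \<otimes> X) \<cdot> (Y \<otimes> A \<otimes> X \<lhd> d \<rhd> Y \<otimes> X \<otimes> X) \<cdot> (Y \<lhd> \<delta> \<rhd> Y \<otimes> Y \<otimes> X \<otimes> X)
      \<cdot> (Y \<otimes> X \<lhd> ((Y \<lhd> b \<rhd> X) \<cdot> b)) \<cdot> b
    = (Y \<otimes> A \<lhd> d \<rhd> X \<otimes> X) \<cdot> (Y \<otimes> A \<otimes> X \<lhd> d \<rhd> Y \<otimes> X \<otimes> X)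
      \<cdot> (Y \<lhd> ((\<delta> \<rhd> Y \<otimes> Y \<otimes> X \<otimes> X) \<cdot> (X \<lhd> ((Y \<lhd> b \<rhd> X) \<cdot> b)))) \<cdot> b"
    by (simp add: typed normal)
  also have "(\<delta> \<rhd> Y \<otimes> Y \<otimes> X \<otimes> X) \<cdot> (X \<lhd> ((Y \<lhd> b \<rhd> X) \<cdot> b))
      = (A \<otimes> X \<otimes> X \<lhd> ((Y \<lhd> b \<rhd> X) \<cdot> b)) \<cdot> \<delta>"
    using exch[of \<delta> "(Y \<lhd> b \<rhd> X) \<cdot> b"] by (simp add: typed)
  also have "(Y \<otimes> A \<lhd> d \<rhd> X \<otimes> X) \<cdot> (Y \<otimes> A \<otimes> X \<lhd> d \<rhd> Y \<otimes> X \<otimes> X)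
      \<cdot> (Y \<lhd> ((A \<otimes> X \<otimes> X \<lhd> ((Y \<lhd> b \<rhd> X) \<cdot> b)) \<cdot> \<delta>)) \<cdot> b
    = (Y \<otimes> A \<lhd> d \<rhd> X \<otimes> X) \<cdot> (Y \<otimes> A \<otimes> X \<lhd> ((d \<rhd> Y \<otimes> X \<otimes> X) \<cdot> (X \<otimes> Y \<lhd> b \<rhd> X)))
      \<cdot> (Y \<otimes> A \<otimes> X \<otimes> X \<lhd> b) \<cdot> (Y \<lhd> \<delta>) \<cdot> b"
    by (simp add: typed normal)
  also have "(d \<rhd> Y \<otimes> X \<otimes> X) \<cdot> (X \<otimes> Y \<lhd> b \<rhd> X) = (b \<rhd> X) \<cdot> (d \<rhd> X)"
    using exch[of d "b \<rhd> X"] by (simp add: typed)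
  also have "(Y \<otimes> A \<lhd> d \<rhd> X \<otimes> X) \<cdot> (Y \<otimes> A \<otimes> X \<lhd> ((b \<rhd> X) \<cdot> (d \<rhd> X)))
      \<cdot> (Y \<otimes> A \<otimes> X \<otimes> X \<lhd> b) \<cdot> (Y \<lhd> \<delta>) \<cdot> b
    = (Y \<otimes> A \<lhd> ((d \<rhd> X) \<cdot> (X \<lhd> b)) \<rhd> X) \<cdot> (Y \<otimes> A \<otimes> X \<lhd> ((d \<rhd> X) \<cdot> (X \<lhd> b))) \<cdot> (Y \<lhd> \<delta>) \<cdot> b"
    by (simp add: typed normal)
  finally show ?thesis by (simp add: snake typed)
qed

lemma wreath_unit_transpose: "wreath_unit C Y b \<epsilon> = transpose \<one> \<epsilon>"
  by (simp add: wreath_unit_def transpose_def typed)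

text \<open>The canonical morphism from \<open>A\<close> to \<open>YA\<close> preserves units:
  \<eta> slides past \<epsilon>, and the unit law gives
  \<open>p \<cdot> (X \<lhd> \<eta>) = \<epsilon>\<close>.\<close>

lemma transpose_p_unit: "transpose A p \<cdot> \<eta> = transpose \<one> \<epsilon>"
proof -
  have "p \<cdot> (X \<lhd> \<eta>) = m \<cdot> ((\<epsilon> \<rhd> A) \<cdot> (X \<lhd> \<eta>))" by (simp add: p_def typed normal)
  also have "(\<epsilon> \<rhd> A) \<cdot> (X \<lhd> \<eta>) = (A \<lhd> \<eta>) \<cdot> \<epsilon>" using exch[of \<epsilon> \<eta>] by (simp add: typed)
  also have "m \<cdot> (A \<lhd> \<eta>) \<cdot> \<epsilon> = (m \<cdot> (A \<lhd> \<eta>)) \<cdot> \<epsilon>" by (simp add: typed normal)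
  finally have "p \<cdot> (X \<lhd> \<eta>) = \<epsilon>" by (simp add: mult_unit typed)
  then show ?thesis by (subst transpose_comp) (simp_all add: typed p_q_typing)
qed

end

section \<open>The categories of modules and of entwined modules\<close>

context right_monoidal_action
begin

lemma right_module_typing:
  assumes "right_module C D S n u M \<nu>"
  shows "M \<in> Ob D" "\<nu> \<in> Ar D" "Dom D \<nu> = M \<odot>\<^bsub>D\<^esub> S" "Cod D \<nu> = M"
  using assms by (auto simp: right_module_def module.in_hom_iff)

lemma entwined_module_typing:
  assumes "entwined_module C D A m \<eta> X \<psi> \<delta> \<epsilon> M \<mu> \<rho>"
  shows "M \<in> Ob D" "\<mu> \<in> Ar D" "Dom D \<mu> = M \<odot>\<^bsub>D\<^esub> A" "Cod D \<mu> = M"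
    "\<rho> \<in> Ar D" "Dom D \<rho> = M" "Cod D \<rho> = M \<odot>\<^bsub>D\<^esub> X"
  using assms by (auto simp: entwined_module_def right_module_def module.in_hom_iff)

lemma right_linear_Id:
  assumes "S \<in> Ob C" "right_module C D S n u M \<mu>"
  shows "right_linear C D S \<mu> \<mu> (Id\<^bsub>D\<^esub> M)"
  using assms(1) by (simp add: right_linear_def act_basics right_module_typing[OF assms(2)])

lemma right_linear_comp:
  assumes modules: "right_module C D S n u M \<mu>" "right_module C D S n u N \<nu>" "right_module C D S n u P \<kappa>"
    and "S \<in> Ob C" "f \<in> Ar D" "Dom D f = M" "Cod D f = N" "g \<in> Ar D" "Dom D g = N" "Cod D g = P"
    and lin: "right_linear C D S \<mu> \<nu> f" "right_linear C D S \<nu> \<kappa> g"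
  shows "right_linear C D S \<mu> \<kappa> (g \<cdot>\<^bsub>D\<^esub> f)"
proof -
  note t = act_basics assms(4-10) modules[THEN right_module_typing(1)] modules[THEN right_module_typing(2)]
    modules[THEN right_module_typing(3)] modules[THEN right_module_typing(4)]
  have "(g \<cdot>\<^bsub>D\<^esub> f) \<cdot>\<^bsub>D\<^esub> \<mu> = g \<cdot>\<^bsub>D\<^esub> (f \<cdot>\<^bsub>D\<^esub> \<mu>)" by (simp add: t act_normal)
  also have "\<dots> = (g \<cdot>\<^bsub>D\<^esub> \<nu>) \<cdot>\<^bsub>D\<^esub> (f \<boxdot>\<^bsub>D\<^esub> Id S)"
    using lin(1) by (simp add: right_linear_def t act_normal)
  also have "\<dots> = \<kappa> \<cdot>\<^bsub>D\<^esub> ((g \<cdot>\<^bsub>D\<^esub> f) \<boxdot>\<^bsub>D\<^esub> Id S)"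
    using lin(2) by (simp add: right_linear_def t act_normal)
  finally show ?thesis by (simp add: right_linear_def)
qed

lemma colinear_comp:
  assumes arrows: "\<rho> \<in> Ar D" "Dom D \<rho> = M" "Cod D \<rho> = M \<odot>\<^bsub>D\<^esub> X"
    "\<sigma> \<in> Ar D" "Dom D \<sigma> = N" "Cod D \<sigma> = N \<odot>\<^bsub>D\<^esub> X"
    "\<tau> \<in> Ar D" "Dom D \<tau> = P" "Cod D \<tau> = P \<odot>\<^bsub>D\<^esub> X"
    "X \<in> Ob C" "f \<in> Ar D" "Dom D f = M" "Cod D f = N" "g \<in> Ar D" "Dom D g = N" "Cod D g = P"
    and colin: "(f \<boxdot>\<^bsub>D\<^esub> Id X) \<cdot>\<^bsub>D\<^esub> \<rho> = \<sigma> \<cdot>\<^bsub>D\<^esub> f" "(g \<boxdot>\<^bsub>D\<^esub> Id X) \<cdot>\<^bsub>D\<^esub> \<sigma> = \<tau> \<cdot>\<^bsub>D\<^esub> g"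
  shows "((g \<cdot>\<^bsub>D\<^esub> f) \<boxdot>\<^bsub>D\<^esub> Id X) \<cdot>\<^bsub>D\<^esub> \<rho> = \<tau> \<cdot>\<^bsub>D\<^esub> (g \<cdot>\<^bsub>D\<^esub> f)"
proof -
  note t = act_basics arrows
  have "((g \<cdot>\<^bsub>D\<^esub> f) \<boxdot>\<^bsub>D\<^esub> Id X) \<cdot>\<^bsub>D\<^esub> \<rho> = ((g \<boxdot>\<^bsub>D\<^esub> Id X) \<cdot>\<^bsub>D\<^esub> \<sigma>) \<cdot>\<^bsub>D\<^esub> f"
    using colin(1) by (simp add: t act_normal)
  then show ?thesis unfolding colin(2) by (simp add: t act_normal)
qed

lemma module_category_Ob: "(M, \<mu>) \<in> Ob (module_category C D S n u) \<longleftrightarrow> right_module C D S n u M \<mu>"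
  by (simp add: module_category_def)

lemma module_category_Ar:
  "((M, \<mu>), f, (N, \<nu>)) \<in> Ar (module_category C D S n u) \<longleftrightarrow>
    right_module C D S n u M \<mu> \<and> right_module C D S n u N \<nu> \<and>
    f \<in> Ar D \<and> Dom D f = M \<and> Cod D f = N \<and> right_linear C D S \<mu> \<nu> f"
  by (auto simp: module_category_def module.in_hom_iff)

lemma module_category_ops:
  "Dom (module_category C D S n u) (P, f, Q) = P"
  "Cod (module_category C D S n u) (P, f, Q) = Q"
  "Id\<^bsub>module_category C D S n u\<^esub> (M, \<mu>) = ((M, \<mu>), Id\<^bsub>D\<^esub> M, (M, \<mu>))"
  "(P', g, R) \<cdot>\<^bsub>module_category C D S n u\<^esub> (P, f, Q) = (P, g \<cdot>\<^bsub>D\<^esub> f, R)"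
  by (simp_all add: module_category_def)

lemma category_module_category:
  assumes "S \<in> Ob C"
  shows "category (module_category C D S n u)"
  using assms
  by (unfold_locales; auto simp: Defs.hom_def module_category_Ob module_category_Ar
      module_category_ops act_basics right_module_typing module.comp_assoc_Ar right_linear_Id;
      metis right_linear_comp)

lemma entwined_category_Ob:
  "(M, \<mu>, \<rho>) \<in> Ob (entwined_category C D A m \<eta> X \<psi> \<delta> \<epsilon>) \<longleftrightarrow>
    entwined_module C D A m \<eta> X \<psi> \<delta> \<epsilon> M \<mu> \<rho>"
  by (simp add: entwined_category_def)

lemma entwined_category_Ar:
  "((M, \<mu>, \<rho>), f, (N, \<nu>, \<sigma>)) \<in> Ar (entwined_category C D A m \<eta> X \<psi> \<delta> \<epsilon>) \<longleftrightarrow>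
    entwined_module C D A m \<eta> X \<psi> \<delta> \<epsilon> M \<mu> \<rho> \<and> entwined_module C D A m \<eta> X \<psi> \<delta> \<epsilon> N \<nu> \<sigma> \<and>
    f \<in> Ar D \<and> Dom D f = M \<and> Cod D f = N \<and> right_linear C D A \<mu> \<nu> f \<and>
    (f \<boxdot>\<^bsub>D\<^esub> Id X) \<cdot>\<^bsub>D\<^esub> \<rho> = \<sigma> \<cdot>\<^bsub>D\<^esub> f"
  by (auto simp: entwined_category_def module.in_hom_iff)

lemma entwined_category_ops:
  "Dom (entwined_category C D A m \<eta> X \<psi> \<delta> \<epsilon>) (P, f, Q) = P"
  "Cod (entwined_category C D A m \<eta> X \<psi> \<delta> \<epsilon>) (P, f, Q) = Q"
  "Id\<^bsub>entwined_category C D A m \<eta> X \<psi> \<delta> \<epsilon>\<^esub> (M, \<mu>, \<rho>) = ((M, \<mu>, \<rho>), Id\<^bsub>D\<^esub> M, (M, \<mu>, \<rho>))"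
  "(P', g, R) \<cdot>\<^bsub>entwined_category C D A m \<eta> X \<psi> \<delta> \<epsilon>\<^esub> (P, f, Q) = (P, g \<cdot>\<^bsub>D\<^esub> f, R)"
  by (simp_all add: entwined_category_def)

lemma category_entwined_category:
  assumes "A \<in> Ob C" "X \<in> Ob C"
  shows "category (entwined_category C D A m \<eta> X \<psi> \<delta> \<epsilon>)"
proof -
  have linear_Id: "right_linear C D A \<mu> \<mu> (Id\<^bsub>D\<^esub> M)"
    if "entwined_module C D A m \<eta> X \<psi> \<delta> \<epsilon> M \<mu> \<rho>" for M \<mu> \<rho>
    using that assms(1) by (auto simp: entwined_module_def intro: right_linear_Id)
  have linear_comp: "right_linear C D A \<mu> \<kappa> (g \<cdot>\<^bsub>D\<^esub> f)"
    if "entwined_module C D A m \<eta> X \<psi> \<delta> \<epsilon> M \<mu> \<rho>" "entwined_module C D A m \<eta> X \<psi> \<delta> \<epsilon> N \<nu> \<sigma>"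
      "entwined_module C D A m \<eta> X \<psi> \<delta> \<epsilon> P \<kappa> \<tau>" "f \<in> Ar D" "Dom D f = M" "Cod D f = N"
      "g \<in> Ar D" "Dom D g = N" "Cod D g = P" "right_linear C D A \<mu> \<nu> f" "right_linear C D A \<nu> \<kappa> g"
    for M \<mu> \<rho> N \<nu> \<sigma> P \<kappa> \<tau> f g
    using that assms(1) by (metis right_linear_comp entwined_module_def)
  have colinear: "((g \<cdot>\<^bsub>D\<^esub> f) \<boxdot>\<^bsub>D\<^esub> Id X) \<cdot>\<^bsub>D\<^esub> \<rho> = \<tau> \<cdot>\<^bsub>D\<^esub> (g \<cdot>\<^bsub>D\<^esub> f)"
    if "entwined_module C D A m \<eta> X \<psi> \<delta> \<epsilon> M \<mu> \<rho>" "entwined_module C D A m \<eta> X \<psi> \<delta> \<epsilon> N \<nu> \<sigma>"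
      "entwined_module C D A m \<eta> X \<psi> \<delta> \<epsilon> P \<kappa> \<tau>" "f \<in> Ar D" "Dom D f = M" "Cod D f = N"
      "g \<in> Ar D" "Dom D g = N" "Cod D g = P"
      "(f \<boxdot>\<^bsub>D\<^esub> Id X) \<cdot>\<^bsub>D\<^esub> \<rho> = \<sigma> \<cdot>\<^bsub>D\<^esub> f" "(g \<boxdot>\<^bsub>D\<^esub> Id X) \<cdot>\<^bsub>D\<^esub> \<sigma> = \<tau> \<cdot>\<^bsub>D\<^esub> g"
    for M \<mu> \<rho> N \<nu> \<sigma> P \<kappa> \<tau> f g
    by (rule colinear_comp[OF _ _ _ _ _ _ _ _ _ assms(2) that(4-)])
      (use that(1-3) entwined_module_typing in auto)
  show ?thesis
    by (unfold_locales; auto simp: Defs.hom_def entwined_category_Ob entwined_category_Ar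
        entwined_category_ops act_basics assms entwined_module_typing module.comp_assoc_Ar linear_Id;
        metis linear_comp colinear)
qed

end

section \<open>Actions of morphisms \<open>XZ \<rightarrow> A\<close> on both kinds of
  modules\<close>

locale cowreath_action = cowreath_adjunction C A X Y m \<eta> \<psi> \<delta> \<epsilon> b d + right_monoidal_action C D
  for C :: "('o, 'm, 'x) moncat_scheme" (structure)
    and D :: "('d, 'n, 'o, 'm, 'y) actcat_scheme"
    and A X Y :: 'o and m \<eta> \<psi> \<delta> \<epsilon> b d :: 'm
begin

lemmas act_typed = act_basics objects arrows

abbreviation "YA \<equiv> Y \<otimes> A"
abbreviation "entwined \<equiv> entwined_module C D A m \<eta> X \<psi> \<delta> \<epsilon>"
abbreviation "wreath_module \<equiv> right_module C D YA wmult (wreath_unit C Y b \<epsilon>)"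

text \<open>\<open>coact M \<mu> \<rho> Z f\<close> is \<open>\<langle>f\<rangle>\<close>; \<open>wact\<close> is its counterpart for \<open>YA\<close>-modules.\<close>

definition coact :: "'d \<Rightarrow> 'n \<Rightarrow> 'n \<Rightarrow> 'o \<Rightarrow> 'm \<Rightarrow> 'n"
  where "coact M \<mu> \<rho> Z f = \<mu> \<cdot>\<^bsub>D\<^esub> (Id\<^bsub>D\<^esub> M \<boxdot>\<^bsub>D\<^esub> f) \<cdot>\<^bsub>D\<^esub> (\<rho> \<boxdot>\<^bsub>D\<^esub> Id Z)"

definition wact :: "'d \<Rightarrow> 'n \<Rightarrow> 'o \<Rightarrow> 'm \<Rightarrow> 'n"
  where "wact M \<nu> Z f = \<nu> \<cdot>\<^bsub>D\<^esub> (Id\<^bsub>D\<^esub> M \<boxdot>\<^bsub>D\<^esub> transpose Z f)"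

text \<open>Acting with \<open>Y\<close> is left adjoint to acting with \<open>X\<close> on
  \<open>D\<close>, with unit given by \<open>b\<close>. This is the transpose of the action of
  \<open>q\<close> under that adjunction.\<close>

definition coaction :: "'d \<Rightarrow> 'n \<Rightarrow> 'n"
  where "coaction M \<nu> = (wact M \<nu> Y q \<boxdot>\<^bsub>D\<^esub> Id X) \<cdot>\<^bsub>D\<^esub> (Id\<^bsub>D\<^esub> M \<boxdot>\<^bsub>D\<^esub> b)"

lemma coact_typing:
  assumes "entwined M \<mu> \<rho>" "Z \<in> Ob C" "f \<in> Ar C" "Dom C f = X \<otimes> Z" "Cod C f = A"
  shows "coact M \<mu> \<rho> Z f \<in> Ar D" "Dom D (coact M \<mu> \<rho> Z f) = M \<odot>\<^bsub>D\<^esub> Z" "Cod D (coact M \<mu> \<rho> Z f) = M"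
  using assms(2-) by (simp_all add: coact_def act_typed entwined_module_typing[OF assms(1)])

lemma wact_typing:
  assumes "M \<in> Ob D" "\<nu> \<in> Ar D" "Dom D \<nu> = M \<odot>\<^bsub>D\<^esub> YA" "Cod D \<nu> = M"
    "Z \<in> Ob C" "f \<in> Ar C" "Dom C f = X \<otimes> Z" "Cod C f = A"
  shows "wact M \<nu> Z f \<in> Ar D" "Dom D (wact M \<nu> Z f) = M \<odot>\<^bsub>D\<^esub> Z" "Cod D (wact M \<nu> Z f) = M"
  using assms by (simp_all add: wact_def act_typed transpose_typing)

text \<open>Naturality in \<open>Z\<close>: the coaction and \<open>u\<close> act on different
  factors.\<close>

lemma coact_comp:
  assumes M: "entwined M \<mu> \<rho>" and f: "f \<in> Ar C" "Dom C f = X \<otimes> Z" "Cod C f = A"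
    and u: "u \<in> Ar C" "Dom C u = W" "Cod C u = Z"
  shows "coact M \<mu> \<rho> Z f \<cdot>\<^bsub>D\<^esub> (Id\<^bsub>D\<^esub> M \<boxdot>\<^bsub>D\<^esub> u) = coact M \<mu> \<rho> W (f \<cdot> (X \<lhd> u))"
proof -
  have o: "Z \<in> Ob C" "W \<in> Ob C" using u Dom_Ob Cod_Ob by auto
  note t = act_typed entwined_module_typing[OF M] f u o
  have "coact M \<mu> \<rho> Z f \<cdot>\<^bsub>D\<^esub> (Id\<^bsub>D\<^esub> M \<boxdot>\<^bsub>D\<^esub> u)
    = \<mu> \<cdot>\<^bsub>D\<^esub> (Id\<^bsub>D\<^esub> M \<boxdot>\<^bsub>D\<^esub> f) \<cdot>\<^bsub>D\<^esub> ((\<rho> \<boxdot>\<^bsub>D\<^esub> Id Z) \<cdot>\<^bsub>D\<^esub> (Id\<^bsub>D\<^esub> M \<boxdot>\<^bsub>D\<^esub> u))"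
    by (simp add: coact_def t act_normal)
  also have "(\<rho> \<boxdot>\<^bsub>D\<^esub> Id Z) \<cdot>\<^bsub>D\<^esub> (Id\<^bsub>D\<^esub> M \<boxdot>\<^bsub>D\<^esub> u) = (Id\<^bsub>D\<^esub> (M \<odot>\<^bsub>D\<^esub> X) \<boxdot>\<^bsub>D\<^esub> u) \<cdot>\<^bsub>D\<^esub> (\<rho> \<boxdot>\<^bsub>D\<^esub> Id W)"
    by (rule act_exchange[symmetric]) (simp_all add: t)
  finally show ?thesis by (simp add: coact_def t act_normal)
qed

text \<open>The axioms enter in the order in which \<open>star\<close> is built: the entwining law
  moves \<rho> past \<mu> and produces \<psi>, coassociativity produces \<delta>, and associativity
  produces the two multiplications.\<close>

lemma coact_coact:
  assumes M: "entwined M \<mu> \<rho>" and o: "W \<in> Ob C" "Z \<in> Ob C"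
    and g: "g \<in> Ar C" "Dom C g = X \<otimes> W" "Cod C g = A"
    and f: "f \<in> Ar C" "Dom C f = X \<otimes> Z" "Cod C f = A"
  shows "coact M \<mu> \<rho> Z f \<cdot>\<^bsub>D\<^esub> (coact M \<mu> \<rho> W g \<boxdot>\<^bsub>D\<^esub> Id Z) = coact M \<mu> \<rho> (W \<otimes> Z) (star W Z g f)"
proof -
  note t = act_typed entwined_module_typing[OF M] f g o
  have entwine: "\<rho> \<cdot>\<^bsub>D\<^esub> \<mu> = (\<mu> \<boxdot>\<^bsub>D\<^esub> Id X) \<cdot>\<^bsub>D\<^esub> (Id\<^bsub>D\<^esub> M \<boxdot>\<^bsub>D\<^esub> \<psi>) \<cdot>\<^bsub>D\<^esub> (\<rho> \<boxdot>\<^bsub>D\<^esub> Id A)"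
    and coassoc: "(\<rho> \<boxdot>\<^bsub>D\<^esub> Id X) \<cdot>\<^bsub>D\<^esub> \<rho>
      = (\<mu> \<boxdot>\<^bsub>D\<^esub> Id (X \<otimes> X)) \<cdot>\<^bsub>D\<^esub> (Id\<^bsub>D\<^esub> M \<boxdot>\<^bsub>D\<^esub> \<delta>) \<cdot>\<^bsub>D\<^esub> \<rho>"
    and assoc: "\<mu> \<cdot>\<^bsub>D\<^esub> (\<mu> \<boxdot>\<^bsub>D\<^esub> Id A) = \<mu> \<cdot>\<^bsub>D\<^esub> (Id\<^bsub>D\<^esub> M \<boxdot>\<^bsub>D\<^esub> m)"
    using M by (auto simp: entwined_module_def right_module_def)
  let ?\<mu> = "\<lambda>V. \<mu> \<boxdot>\<^bsub>D\<^esub> Id V" and ?\<rho> = "\<lambda>V. \<rho> \<boxdot>\<^bsub>D\<^esub> Id V" and ?M = "\<lambda>h. Id\<^bsub>D\<^esub> M \<boxdot>\<^bsub>D\<^esub> h"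
  have \<mu>_exch: "?M h \<cdot>\<^bsub>D\<^esub> ?\<mu> V = ?\<mu> V' \<cdot>\<^bsub>D\<^esub> ?M (A \<lhd> h)"
    if "h \<in> Ar C" "Dom C h = V" "Cod C h = V'" for h V V'
    using act_exchange[of \<mu> "M \<odot>\<^bsub>D\<^esub> A" M h V V'] that by (simp add: t act_nested)
  have "coact M \<mu> \<rho> Z f \<cdot>\<^bsub>D\<^esub> (coact M \<mu> \<rho> W g \<boxdot>\<^bsub>D\<^esub> Id Z)
    = \<mu> \<cdot>\<^bsub>D\<^esub> ?M f \<cdot>\<^bsub>D\<^esub> ((\<rho> \<cdot>\<^bsub>D\<^esub> \<mu>) \<boxdot>\<^bsub>D\<^esub> Id Z) \<cdot>\<^bsub>D\<^esub> ?M (g \<rhd> Z) \<cdot>\<^bsub>D\<^esub> ?\<rho> (W \<otimes> Z)"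
    by (simp add: coact_def t act_normal)
  also have "\<dots> = \<mu> \<cdot>\<^bsub>D\<^esub> ?M f \<cdot>\<^bsub>D\<^esub> ?\<mu> (X \<otimes> Z) \<cdot>\<^bsub>D\<^esub> ?M (\<psi> \<rhd> Z)
      \<cdot>\<^bsub>D\<^esub> (?\<rho> (A \<otimes> Z) \<cdot>\<^bsub>D\<^esub> ?M (g \<rhd> Z)) \<cdot>\<^bsub>D\<^esub> ?\<rho> (W \<otimes> Z)"
    unfolding entwine by (simp add: t act_normal)
  also have "?\<rho> (A \<otimes> Z) \<cdot>\<^bsub>D\<^esub> ?M (g \<rhd> Z) = ?M (X \<lhd> g \<rhd> Z) \<cdot>\<^bsub>D\<^esub> ?\<rho> (X \<otimes> W \<otimes> Z)"
    using act_exchange[of \<rho> M "M \<odot>\<^bsub>D\<^esub> X" "g \<rhd> Z" "X \<otimes> W \<otimes> Z" "A \<otimes> Z"] by (simp add: t act_nested)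
  also have "\<mu> \<cdot>\<^bsub>D\<^esub> ?M f \<cdot>\<^bsub>D\<^esub> ?\<mu> (X \<otimes> Z) \<cdot>\<^bsub>D\<^esub> ?M (\<psi> \<rhd> Z)
      \<cdot>\<^bsub>D\<^esub> (?M (X \<lhd> g \<rhd> Z) \<cdot>\<^bsub>D\<^esub> ?\<rho> (X \<otimes> W \<otimes> Z)) \<cdot>\<^bsub>D\<^esub> ?\<rho> (W \<otimes> Z)
    = \<mu> \<cdot>\<^bsub>D\<^esub> ?M f \<cdot>\<^bsub>D\<^esub> ?\<mu> (X \<otimes> Z) \<cdot>\<^bsub>D\<^esub> ?M (\<psi> \<rhd> Z) \<cdot>\<^bsub>D\<^esub> ?M (X \<lhd> g \<rhd> Z)
      \<cdot>\<^bsub>D\<^esub> (((\<rho> \<boxdot>\<^bsub>D\<^esub> Id X) \<cdot>\<^bsub>D\<^esub> \<rho>) \<boxdot>\<^bsub>D\<^esub> Id (W \<otimes> Z))"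
    by (simp add: t act_normal)
  \<comment> \<open>Coassociativity trades the second \<rho> for \<delta> and one more \<mu>, which
    the next steps move left past \<open>g\<close>, \<psi> and \<open>f\<close>.\<close>
  also have "\<dots> = \<mu> \<cdot>\<^bsub>D\<^esub> (?M f \<cdot>\<^bsub>D\<^esub> ?\<mu> (X \<otimes> Z)) \<cdot>\<^bsub>D\<^esub>
      (?M ((\<psi> \<rhd> Z) \<cdot> (X \<lhd> g \<rhd> Z)) \<cdot>\<^bsub>D\<^esub> ?\<mu> (X \<otimes> X \<otimes> W \<otimes> Z)) \<cdot>\<^bsub>D\<^esub> ?M (\<delta> \<rhd> W \<otimes> Z) \<cdot>\<^bsub>D\<^esub> ?\<rho> (W \<otimes> Z)"
    unfolding coassoc by (simp add: t act_normal)
  also have "?M f \<cdot>\<^bsub>D\<^esub> ?\<mu> (X \<otimes> Z) = ?\<mu> A \<cdot>\<^bsub>D\<^esub> ?M (A \<lhd> f)"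
    by (rule \<mu>_exch) (simp_all add: t)
  also have "?M ((\<psi> \<rhd> Z) \<cdot> (X \<lhd> g \<rhd> Z)) \<cdot>\<^bsub>D\<^esub> ?\<mu> (X \<otimes> X \<otimes> W \<otimes> Z)
      = ?\<mu> (A \<otimes> X \<otimes> Z) \<cdot>\<^bsub>D\<^esub> ?M (A \<lhd> ((\<psi> \<rhd> Z) \<cdot> (X \<lhd> g \<rhd> Z)))"
    by (rule \<mu>_exch) (simp_all add: t)
  also have "\<mu> \<cdot>\<^bsub>D\<^esub> (?\<mu> A \<cdot>\<^bsub>D\<^esub> ?M (A \<lhd> f)) \<cdot>\<^bsub>D\<^esub>
      (?\<mu> (A \<otimes> X \<otimes> Z) \<cdot>\<^bsub>D\<^esub> ?M (A \<lhd> ((\<psi> \<rhd> Z) \<cdot> (X \<lhd> g \<rhd> Z)))) \<cdot>\<^bsub>D\<^esub> ?M (\<delta> \<rhd> W \<otimes> Z) \<cdot>\<^bsub>D\<^esub> ?\<rho> (W \<otimes> Z)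
    = \<mu> \<cdot>\<^bsub>D\<^esub> ?\<mu> A \<cdot>\<^bsub>D\<^esub> (?M (A \<lhd> f) \<cdot>\<^bsub>D\<^esub> ?\<mu> (A \<otimes> X \<otimes> Z)) \<cdot>\<^bsub>D\<^esub>
      ?M (A \<lhd> ((\<psi> \<rhd> Z) \<cdot> (X \<lhd> g \<rhd> Z))) \<cdot>\<^bsub>D\<^esub> ?M (\<delta> \<rhd> W \<otimes> Z) \<cdot>\<^bsub>D\<^esub> ?\<rho> (W \<otimes> Z)"
    by (simp add: t act_normal normal)
  also have "?M (A \<lhd> f) \<cdot>\<^bsub>D\<^esub> ?\<mu> (A \<otimes> X \<otimes> Z) = ?\<mu> (A \<otimes> A) \<cdot>\<^bsub>D\<^esub> ?M (A \<lhd> (A \<lhd> f))"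
    by (rule \<mu>_exch) (simp_all add: t)
  also have "\<mu> \<cdot>\<^bsub>D\<^esub> ?\<mu> A \<cdot>\<^bsub>D\<^esub> (?\<mu> (A \<otimes> A) \<cdot>\<^bsub>D\<^esub> ?M (A \<lhd> (A \<lhd> f))) \<cdot>\<^bsub>D\<^esub>
      ?M (A \<lhd> ((\<psi> \<rhd> Z) \<cdot> (X \<lhd> g \<rhd> Z))) \<cdot>\<^bsub>D\<^esub> ?M (\<delta> \<rhd> W \<otimes> Z) \<cdot>\<^bsub>D\<^esub> ?\<rho> (W \<otimes> Z)
    = \<mu> \<cdot>\<^bsub>D\<^esub> ((\<mu> \<cdot>\<^bsub>D\<^esub> ?\<mu> A) \<boxdot>\<^bsub>D\<^esub> Id A) \<cdot>\<^bsub>D\<^esub> ?M (A \<lhd> (A \<lhd> f)) \<cdot>\<^bsub>D\<^esub>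
      ?M (A \<lhd> ((\<psi> \<rhd> Z) \<cdot> (X \<lhd> g \<rhd> Z))) \<cdot>\<^bsub>D\<^esub> ?M (\<delta> \<rhd> W \<otimes> Z) \<cdot>\<^bsub>D\<^esub> ?\<rho> (W \<otimes> Z)"
    by (simp add: t act_normal)
  \<comment> \<open>The three copies of \<mu> are now adjacent, and associativity applied twice
    turns them into a single \<mu> after \<open>m \<cdot> (m \<rhd> A)\<close>.\<close>
  also have "\<dots> = \<mu> \<cdot>\<^bsub>D\<^esub> ((\<mu> \<cdot>\<^bsub>D\<^esub> ?M m) \<boxdot>\<^bsub>D\<^esub> Id A) \<cdot>\<^bsub>D\<^esub> ?M (A \<lhd> (A \<lhd> f)) \<cdot>\<^bsub>D\<^esub>
      ?M (A \<lhd> ((\<psi> \<rhd> Z) \<cdot> (X \<lhd> g \<rhd> Z))) \<cdot>\<^bsub>D\<^esub> ?M (\<delta> \<rhd> W \<otimes> Z) \<cdot>\<^bsub>D\<^esub> ?\<rho> (W \<otimes> Z)"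
    unfolding assoc ..
  also have "\<dots> = (\<mu> \<cdot>\<^bsub>D\<^esub> ?\<mu> A) \<cdot>\<^bsub>D\<^esub> ?M (m \<rhd> A) \<cdot>\<^bsub>D\<^esub> ?M (A \<lhd> (A \<lhd> f)) \<cdot>\<^bsub>D\<^esub>
      ?M (A \<lhd> ((\<psi> \<rhd> Z) \<cdot> (X \<lhd> g \<rhd> Z))) \<cdot>\<^bsub>D\<^esub> ?M (\<delta> \<rhd> W \<otimes> Z) \<cdot>\<^bsub>D\<^esub> ?\<rho> (W \<otimes> Z)"
    by (simp add: t act_normal)
  also have "\<dots> = coact M \<mu> \<rho> (W \<otimes> Z) (star W Z g f)"
    unfolding assoc coact_def star_def by (simp add: t act_normal normal)
  finally show ?thesis .
qed

lemma coact_\<epsilon>: "coact M \<mu> \<rho> \<one> \<epsilon> = Id\<^bsub>D\<^esub> M" if "entwined M \<mu> \<rho>"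
  using that entwined_module_typing[OF that]
  by (simp add: coact_def entwined_module_def act_typed)

text \<open>Associativity splits the \<open>m\<close> in \<open>p\<close> into two actions, and the
  inner one together with \<rho> is the counit axiom.\<close>

lemma coact_p: "coact M \<mu> \<rho> A p = \<mu>" if M: "entwined M \<mu> \<rho>"
proof -
  note t = act_typed entwined_module_typing[OF M]
  have assoc: "\<mu> \<cdot>\<^bsub>D\<^esub> (\<mu> \<boxdot>\<^bsub>D\<^esub> Id A) = \<mu> \<cdot>\<^bsub>D\<^esub> (Id\<^bsub>D\<^esub> M \<boxdot>\<^bsub>D\<^esub> m)"
    and counit: "\<mu> \<cdot>\<^bsub>D\<^esub> (Id\<^bsub>D\<^esub> M \<boxdot>\<^bsub>D\<^esub> \<epsilon>) \<cdot>\<^bsub>D\<^esub> \<rho> = Id\<^bsub>D\<^esub> M"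
    using M by (auto simp: entwined_module_def right_module_def)
  have "coact M \<mu> \<rho> A p = (\<mu> \<cdot>\<^bsub>D\<^esub> (Id\<^bsub>D\<^esub> M \<boxdot>\<^bsub>D\<^esub> m)) \<cdot>\<^bsub>D\<^esub> (Id\<^bsub>D\<^esub> M \<boxdot>\<^bsub>D\<^esub> (\<epsilon> \<rhd> A)) \<cdot>\<^bsub>D\<^esub> (\<rho> \<boxdot>\<^bsub>D\<^esub> Id A)"
    by (simp add: coact_def p_def t act_normal)
  also have "\<dots> = \<mu> \<cdot>\<^bsub>D\<^esub> ((\<mu> \<cdot>\<^bsub>D\<^esub> (Id\<^bsub>D\<^esub> M \<boxdot>\<^bsub>D\<^esub> \<epsilon>) \<cdot>\<^bsub>D\<^esub> \<rho>) \<boxdot>\<^bsub>D\<^esub> Id A)"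
    unfolding assoc[symmetric] by (simp add: t act_normal)
  finally show ?thesis unfolding counit by (simp add: t)
qed

text \<open>The unit axiom removes the \<eta> in \<open>q\<close>. Then \<rho> slides past
  \<open>b\<close>, and \<open>b\<close> cancels with \<open>d\<close> by the second snake
  identity.\<close>

lemma coact_q:
  assumes M: "entwined M \<mu> \<rho>"
  shows "(coact M \<mu> \<rho> Y q \<boxdot>\<^bsub>D\<^esub> Id X) \<cdot>\<^bsub>D\<^esub> (Id\<^bsub>D\<^esub> M \<boxdot>\<^bsub>D\<^esub> b) = \<rho>"
proof -
  note t = act_typed entwined_module_typing[OF M]
  have unit: "\<mu> \<cdot>\<^bsub>D\<^esub> (Id\<^bsub>D\<^esub> M \<boxdot>\<^bsub>D\<^esub> \<eta>) = Id\<^bsub>D\<^esub> M"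
    using M by (auto simp: entwined_module_def right_module_def)
  have "(coact M \<mu> \<rho> Y q \<boxdot>\<^bsub>D\<^esub> Id X) \<cdot>\<^bsub>D\<^esub> (Id\<^bsub>D\<^esub> M \<boxdot>\<^bsub>D\<^esub> b)
    = ((\<mu> \<cdot>\<^bsub>D\<^esub> (Id\<^bsub>D\<^esub> M \<boxdot>\<^bsub>D\<^esub> \<eta>)) \<boxdot>\<^bsub>D\<^esub> Id X) \<cdot>\<^bsub>D\<^esub> (Id\<^bsub>D\<^esub> M \<boxdot>\<^bsub>D\<^esub> (d \<rhd> X))
      \<cdot>\<^bsub>D\<^esub> ((\<rho> \<boxdot>\<^bsub>D\<^esub> Id (Y \<otimes> X)) \<cdot>\<^bsub>D\<^esub> (Id\<^bsub>D\<^esub> M \<boxdot>\<^bsub>D\<^esub> b))"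
    by (simp add: coact_def q_def t act_normal normal)
  also have "(\<rho> \<boxdot>\<^bsub>D\<^esub> Id (Y \<otimes> X)) \<cdot>\<^bsub>D\<^esub> (Id\<^bsub>D\<^esub> M \<boxdot>\<^bsub>D\<^esub> b) = (Id\<^bsub>D\<^esub> M \<boxdot>\<^bsub>D\<^esub> (X \<lhd> b)) \<cdot>\<^bsub>D\<^esub> \<rho>"
    using act_exchange[of \<rho> M "M \<odot>\<^bsub>D\<^esub> X" b \<one> "Y \<otimes> X"] by (simp add: t act_nested)
  also have "((\<mu> \<cdot>\<^bsub>D\<^esub> (Id\<^bsub>D\<^esub> M \<boxdot>\<^bsub>D\<^esub> \<eta>)) \<boxdot>\<^bsub>D\<^esub> Id X) \<cdot>\<^bsub>D\<^esub> (Id\<^bsub>D\<^esub> M \<boxdot>\<^bsub>D\<^esub> (d \<rhd> X))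
      \<cdot>\<^bsub>D\<^esub> (Id\<^bsub>D\<^esub> M \<boxdot>\<^bsub>D\<^esub> (X \<lhd> b)) \<cdot>\<^bsub>D\<^esub> \<rho>
    = (Id\<^bsub>D\<^esub> M \<boxdot>\<^bsub>D\<^esub> ((d \<rhd> X) \<cdot> (X \<lhd> b))) \<cdot>\<^bsub>D\<^esub> \<rho>"
    unfolding unit by (simp add: t act_normal)
  finally show ?thesis by (simp add: snake t)
qed

lemma wact_comp:
  assumes M: "M \<in> Ob D" "\<nu> \<in> Ar D" "Dom D \<nu> = M \<odot>\<^bsub>D\<^esub> YA" "Cod D \<nu> = M"
    and f: "f \<in> Ar C" "Dom C f = X \<otimes> Z" "Cod C f = A"
    and u: "u \<in> Ar C" "Dom C u = W" "Cod C u = Z"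
  shows "wact M \<nu> Z f \<cdot>\<^bsub>D\<^esub> (Id\<^bsub>D\<^esub> M \<boxdot>\<^bsub>D\<^esub> u) = wact M \<nu> W (f \<cdot> (X \<lhd> u))"
proof -
  have o: "Z \<in> Ob C" "W \<in> Ob C" using u Dom_Ob Cod_Ob by auto
  have "wact M \<nu> Z f \<cdot>\<^bsub>D\<^esub> (Id\<^bsub>D\<^esub> M \<boxdot>\<^bsub>D\<^esub> u) = \<nu> \<cdot>\<^bsub>D\<^esub> (Id\<^bsub>D\<^esub> M \<boxdot>\<^bsub>D\<^esub> (transpose Z f \<cdot> u))"
    by (simp add: wact_def act_typed M f u o transpose_typing act_normal)
  then show ?thesis
    using transpose_comp[OF f(1,2) u] by (simp add: wact_def)
qed

text \<open>Associativity of \<nu> turns the iterated action into the action of a product in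
  \<open>YA\<close>, which \<open>wreath_mult_tensor\<close> computes as the transpose of
  \<open>star\<close>.\<close>

lemma wact_wact:
  assumes M: "wreath_module M \<nu>" and o: "W \<in> Ob C" "Z \<in> Ob C"
    and g: "g \<in> Ar C" "Dom C g = X \<otimes> W" "Cod C g = A"
    and f: "f \<in> Ar C" "Dom C f = X \<otimes> Z" "Cod C f = A"
  shows "wact M \<nu> Z f \<cdot>\<^bsub>D\<^esub> (wact M \<nu> W g \<boxdot>\<^bsub>D\<^esub> Id Z) = wact M \<nu> (W \<otimes> Z) (star W Z g f)"
proof -
  note t = act_typed right_module_typing[OF M] f g o transpose_typing
  let ?f = "transpose Z f" and ?g = "transpose W g" and ?M = "\<lambda>h. Id\<^bsub>D\<^esub> M \<boxdot>\<^bsub>D\<^esub> h"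
  have n: "wmult \<in> Ar C" "Dom C wmult = Y \<otimes> A \<otimes> Y \<otimes> A" "Cod C wmult = YA"
    by (simp_all add: wreath_mult_transpose transpose_typing star_typing typed)
  have assoc: "\<nu> \<cdot>\<^bsub>D\<^esub> (\<nu> \<boxdot>\<^bsub>D\<^esub> Id YA) = \<nu> \<cdot>\<^bsub>D\<^esub> ?M wmult"
    using M by (auto simp: right_module_def)
  have "wact M \<nu> Z f \<cdot>\<^bsub>D\<^esub> (wact M \<nu> W g \<boxdot>\<^bsub>D\<^esub> Id Z)
    = \<nu> \<cdot>\<^bsub>D\<^esub> (?M ?f \<cdot>\<^bsub>D\<^esub> (\<nu> \<boxdot>\<^bsub>D\<^esub> Id Z)) \<cdot>\<^bsub>D\<^esub> ?M (?g \<rhd> Z)"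
    by (simp add: wact_def t act_normal)
  also have "?M ?f \<cdot>\<^bsub>D\<^esub> (\<nu> \<boxdot>\<^bsub>D\<^esub> Id Z) = (\<nu> \<boxdot>\<^bsub>D\<^esub> Id YA) \<cdot>\<^bsub>D\<^esub> ?M (YA \<lhd> ?f)"
    using act_exchange[of \<nu> "M \<odot>\<^bsub>D\<^esub> YA" M ?f Z YA] by (simp add: t act_nested)
  also have "\<nu> \<cdot>\<^bsub>D\<^esub> ((\<nu> \<boxdot>\<^bsub>D\<^esub> Id YA) \<cdot>\<^bsub>D\<^esub> ?M (YA \<lhd> ?f)) \<cdot>\<^bsub>D\<^esub> ?M (?g \<rhd> Z)
    = (\<nu> \<cdot>\<^bsub>D\<^esub> (\<nu> \<boxdot>\<^bsub>D\<^esub> Id YA)) \<cdot>\<^bsub>D\<^esub> ?M ((YA \<lhd> ?f) \<cdot> (?g \<rhd> Z))"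
    by (simp add: t act_normal)
  also have "(YA \<lhd> ?f) \<cdot> (?g \<rhd> Z) = ?g \<boxtimes> ?f"
    using exch[of ?g ?f] by (simp add: t)
  also have "(\<nu> \<cdot>\<^bsub>D\<^esub> (\<nu> \<boxdot>\<^bsub>D\<^esub> Id YA)) \<cdot>\<^bsub>D\<^esub> ?M (?g \<boxtimes> ?f) = \<nu> \<cdot>\<^bsub>D\<^esub> ?M (wmult \<cdot> (?g \<boxtimes> ?f))"
    unfolding assoc by (simp add: t n act_normal)
  finally show ?thesis
    using wreath_mult_tensor[OF o g f] by (simp add: wact_def)
qed

lemma wact_\<epsilon>: "wact M \<nu> \<one> \<epsilon> = Id\<^bsub>D\<^esub> M" if "wreath_module M \<nu>"
  using that by (simp add: wact_def right_module_def wreath_unit_transpose)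

lemma wact_counit: "wact M \<nu> YA (d \<rhd> A) = \<nu>" if "wreath_module M \<nu>"
  using right_module_typing[OF that] by (simp add: wact_def transpose_counit act_typed)

text \<open>By \<open>coact_comp\<close>, acting through \<open>transpose Z f\<close> amounts to
  untransposing it, which returns \<open>f\<close>. Hence both kinds of action agree when \<nu>
  comes from an entwined module.\<close>

lemma wact_coact:
  assumes "entwined M \<mu> \<rho>" "Z \<in> Ob C" "f \<in> Ar C" "Dom C f = X \<otimes> Z" "Cod C f = A"
  shows "wact M (coact M \<mu> \<rho> YA (d \<rhd> A)) Z f = coact M \<mu> \<rho> Z f"
proof -
  have "wact M (coact M \<mu> \<rho> YA (d \<rhd> A)) Z f
    = coact M \<mu> \<rho> Z ((d \<rhd> A) \<cdot> (X \<lhd> transpose Z f))"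
    unfolding wact_def using assms
    by (subst coact_comp) (simp_all add: typed transpose_typing)
  then show ?thesis
    using assms by (simp add: untranspose_transpose)
qed

section \<open>From entwined modules to modules over \<open>YA\<close>\<close>

text \<open>Associativity is \<open>coact_coact\<close> for two copies of \<open>dA\<close>, whose
  product has the wreath multiplication as transpose. The unit law is the action of \<epsilon>,
  whose transpose is the unit of \<open>YA\<close>.\<close>

lemma wreath_module_of_entwined:
  assumes M: "entwined M \<mu> \<rho>"
  shows "wreath_module M (coact M \<mu> \<rho> YA (d \<rhd> A))"
proof -
  let ?n = "star YA YA (d \<rhd> A) (d \<rhd> A)"
  have n: "?n \<in> Ar C" "Dom C ?n = X \<otimes> YA \<otimes> YA" "Cod C ?n = A"
    by (simp_all add: star_typing typed)
  have "coact M \<mu> \<rho> YA (d \<rhd> A) \<cdot>\<^bsub>D\<^esub> (coact M \<mu> \<rho> YA (d \<rhd> A) \<boxdot>\<^bsub>D\<^esub> Id YA)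
    = coact M \<mu> \<rho> (YA \<otimes> YA) ?n"
    by (rule coact_coact[OF M]) (simp_all add: typed)
  also have "\<dots> = coact M \<mu> \<rho> YA (d \<rhd> A) \<cdot>\<^bsub>D\<^esub> (Id\<^bsub>D\<^esub> M \<boxdot>\<^bsub>D\<^esub> wmult)"
    using wact_coact[OF M _ n] by (simp add: wact_def wreath_mult_transpose typed)
  finally show ?thesis
    using wact_coact[OF M, of \<one> \<epsilon>] coact_\<epsilon>[OF M] coact_typing[OF M, of YA "d \<rhd> A"]
      entwined_module_typing(1)[OF M]
    by (simp add: right_module_def module.in_hom_iff wact_def wreath_unit_transpose typed)
qed

section \<open>From modules over \<open>YA\<close> to entwined modules\<close>

lemma coaction_typing:
  assumes "wreath_module M \<nu>"
  shows "coaction M \<nu> \<in> Ar D" "Dom D (coaction M \<nu>) = M" "Cod D (coaction M \<nu>) = M \<odot>\<^bsub>D\<^esub> X"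
  using right_module_typing[OF assms]
  by (simp_all add: coaction_def act_typed wact_typing p_q_typing)

text \<open>Moving \<open>f\<close> past the action of \<open>q\<close> leaves the action of
  \<open>p\<close> after that of \<open>q\<close>. By \<open>star_q_p\<close> this is the action of
  \<open>dA\<close>, that is, \<nu> itself, applied to the transpose of \<open>f\<close>.\<close>

lemma coact_wact:
  assumes M: "wreath_module M \<nu>"
    and o: "Z \<in> Ob C" and f: "f \<in> Ar C" "Dom C f = X \<otimes> Z" "Cod C f = A"
  shows "coact M (wact M \<nu> A p) (coaction M \<nu>) Z f = wact M \<nu> Z f"
proof -
  let ?M = "\<lambda>h. Id\<^bsub>D\<^esub> M \<boxdot>\<^bsub>D\<^esub> h" and ?q = "wact M \<nu> Y q"
  note t = act_typed right_module_typing[OF M] f o transpose_typing wact_typing p_q_typing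
  have "coact M (wact M \<nu> A p) (coaction M \<nu>) Z f
    = wact M \<nu> A p \<cdot>\<^bsub>D\<^esub> (?M f \<cdot>\<^bsub>D\<^esub> (?q \<boxdot>\<^bsub>D\<^esub> Id (X \<otimes> Z))) \<cdot>\<^bsub>D\<^esub> ?M (b \<rhd> Z)"
    by (simp add: coact_def coaction_def t act_normal)
  also have "?M f \<cdot>\<^bsub>D\<^esub> (?q \<boxdot>\<^bsub>D\<^esub> Id (X \<otimes> Z)) = (?q \<boxdot>\<^bsub>D\<^esub> Id A) \<cdot>\<^bsub>D\<^esub> ?M (Y \<lhd> f)"
    using act_exchange[of ?q "M \<odot>\<^bsub>D\<^esub> Y" M f "X \<otimes> Z" A] by (simp add: t act_nested)
  also have "wact M \<nu> A p \<cdot>\<^bsub>D\<^esub> ((?q \<boxdot>\<^bsub>D\<^esub> Id A) \<cdot>\<^bsub>D\<^esub> ?M (Y \<lhd> f)) \<cdot>\<^bsub>D\<^esub> ?M (b \<rhd> Z)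
    = (wact M \<nu> A p \<cdot>\<^bsub>D\<^esub> (?q \<boxdot>\<^bsub>D\<^esub> Id A)) \<cdot>\<^bsub>D\<^esub> ?M (transpose Z f)"
    by (simp add: transpose_def t act_normal)
  also have "wact M \<nu> A p \<cdot>\<^bsub>D\<^esub> (?q \<boxdot>\<^bsub>D\<^esub> Id A) = wact M \<nu> (Y \<otimes> A) (star Y A q p)"
    by (rule wact_wact[OF M]) (simp_all add: t)
  also have "\<dots> = \<nu>" by (simp only: star_q_p wact_counit[OF M])
  finally show ?thesis by (simp add: wact_def)
qed

text \<open>Each two-step law is an instance of \<open>wact_wact\<close>: associativity comes from
  \<open>star_p_p\<close>, the entwining law from \<open>star_p_q\<close> and coassociativity from
  \<open>star_q_q\<close>.\<close>

lemma entwined_of_wreath_module: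
  assumes M: "wreath_module M \<nu>"
  shows "entwined M (wact M \<nu> A p) (coaction M \<nu>)"
proof -
  let ?M = "\<lambda>h. Id\<^bsub>D\<^esub> M \<boxdot>\<^bsub>D\<^esub> h" and ?p = "wact M \<nu> A p" and ?q = "wact M \<nu> Y q"
    and ?\<rho> = "coaction M \<nu>"
  note t = act_typed right_module_typing[OF M] transpose_typing wact_typing star_typing p_q_typing
    coaction_typing[OF M]
  have \<nu>: "wact M \<nu> Z f = \<nu> \<cdot>\<^bsub>D\<^esub> ?M (transpose Z f)" for Z f
    by (simp add: wact_def)
  have q_exch: "?M h \<cdot>\<^bsub>D\<^esub> (?q \<boxdot>\<^bsub>D\<^esub> Id V) = (?q \<boxdot>\<^bsub>D\<^esub> Id W) \<cdot>\<^bsub>D\<^esub> ?M (Y \<lhd> h)"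
    if "h \<in> Ar C" "Dom C h = V" "Cod C h = W" for h V W
    using act_exchange[of ?q "M \<odot>\<^bsub>D\<^esub> Y" M h V W] that by (simp add: t act_nested)
  \<comment> \<open>Below, this is also used from right to left: a product computed in terms of
    \<nu> is split again into the actions of \<open>q\<close> and \<open>p\<close>, and the action
    of \<open>q\<close> then combines with \<open>b\<close> into the coaction.\<close>
  have q_p: "?p \<cdot>\<^bsub>D\<^esub> (?q \<boxdot>\<^bsub>D\<^esub> Id A) = \<nu>"
    using wact_wact[OF M, of Y A q p] by (simp add: t star_q_p wact_counit[OF M])
  have assoc: "?p \<cdot>\<^bsub>D\<^esub> (?p \<boxdot>\<^bsub>D\<^esub> Id A) = ?p \<cdot>\<^bsub>D\<^esub> ?M m"
    using wact_wact[OF M, of A A p p] wact_comp[of M \<nu> p A m "A \<otimes> A"] by (simp add: t star_p_p)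
  have unit: "?p \<cdot>\<^bsub>D\<^esub> ?M \<eta> = Id\<^bsub>D\<^esub> M"
  proof -
    have "?p \<cdot>\<^bsub>D\<^esub> ?M \<eta> = \<nu> \<cdot>\<^bsub>D\<^esub> ?M (transpose A p \<cdot> \<eta>)"
      by (simp add: \<nu> t act_normal)
    then show ?thesis using wact_\<epsilon>[OF M] by (simp add: transpose_p_unit \<nu>)
  qed
  have entwine: "?\<rho> \<cdot>\<^bsub>D\<^esub> ?p = (?p \<boxdot>\<^bsub>D\<^esub> Id X) \<cdot>\<^bsub>D\<^esub> ?M \<psi> \<cdot>\<^bsub>D\<^esub> (?\<rho> \<boxdot>\<^bsub>D\<^esub> Id A)"
  proof -
    have "?\<rho> \<cdot>\<^bsub>D\<^esub> ?p = (?q \<boxdot>\<^bsub>D\<^esub> Id X) \<cdot>\<^bsub>D\<^esub> (?M b \<cdot>\<^bsub>D\<^esub> ?p)"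
      by (simp add: coaction_def t act_normal)
    also have "?M b \<cdot>\<^bsub>D\<^esub> ?p = (?p \<boxdot>\<^bsub>D\<^esub> Id (Y \<otimes> X)) \<cdot>\<^bsub>D\<^esub> ?M (A \<lhd> b)"
      using act_exchange[of ?p "M \<odot>\<^bsub>D\<^esub> A" M b \<one> "Y \<otimes> X"] by (simp add: t act_nested)
    also have "(?q \<boxdot>\<^bsub>D\<^esub> Id X) \<cdot>\<^bsub>D\<^esub> (?p \<boxdot>\<^bsub>D\<^esub> Id (Y \<otimes> X)) \<cdot>\<^bsub>D\<^esub> ?M (A \<lhd> b)
      = ((?q \<cdot>\<^bsub>D\<^esub> (?p \<boxdot>\<^bsub>D\<^esub> Id Y)) \<boxdot>\<^bsub>D\<^esub> Id X) \<cdot>\<^bsub>D\<^esub> ?M (A \<lhd> b)"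
      by (simp add: t act_normal)
    also have "?q \<cdot>\<^bsub>D\<^esub> (?p \<boxdot>\<^bsub>D\<^esub> Id Y) = wact M \<nu> (A \<otimes> Y) (star A Y p q)"
      by (rule wact_wact[OF M]) (simp_all add: t)
    also have "(wact M \<nu> (A \<otimes> Y) (star A Y p q) \<boxdot>\<^bsub>D\<^esub> Id X) \<cdot>\<^bsub>D\<^esub> ?M (A \<lhd> b)
      = (\<nu> \<boxdot>\<^bsub>D\<^esub> Id X) \<cdot>\<^bsub>D\<^esub> ?M ((transpose (A \<otimes> Y) (star A Y p q) \<rhd> X) \<cdot> (A \<lhd> b))"
      by (simp add: \<nu> t act_normal)
    also have "\<dots> = ((?p \<cdot>\<^bsub>D\<^esub> (?q \<boxdot>\<^bsub>D\<^esub> Id A)) \<boxdot>\<^bsub>D\<^esub> Id X) \<cdot>\<^bsub>D\<^esub> ?M ((Y \<lhd> \<psi>) \<cdot> (b \<rhd> A))"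
      unfolding transpose_star_p_q q_p ..
    also have "\<dots> = (?p \<boxdot>\<^bsub>D\<^esub> Id X) \<cdot>\<^bsub>D\<^esub> ((?q \<boxdot>\<^bsub>D\<^esub> Id (A \<otimes> X)) \<cdot>\<^bsub>D\<^esub> ?M (Y \<lhd> \<psi>)) \<cdot>\<^bsub>D\<^esub> ?M (b \<rhd> A)"
      by (simp add: t act_normal)
    also have "(?q \<boxdot>\<^bsub>D\<^esub> Id (A \<otimes> X)) \<cdot>\<^bsub>D\<^esub> ?M (Y \<lhd> \<psi>) = ?M \<psi> \<cdot>\<^bsub>D\<^esub> (?q \<boxdot>\<^bsub>D\<^esub> Id (X \<otimes> A))"
      by (rule q_exch[symmetric]) (simp_all add: t)
    finally show ?thesis by (simp add: coaction_def t act_normal)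
  qed
  have coassoc: "(?\<rho> \<boxdot>\<^bsub>D\<^esub> Id X) \<cdot>\<^bsub>D\<^esub> ?\<rho> = (?p \<boxdot>\<^bsub>D\<^esub> Id (X \<otimes> X)) \<cdot>\<^bsub>D\<^esub> ?M \<delta> \<cdot>\<^bsub>D\<^esub> ?\<rho>"
  proof -
    have "(?\<rho> \<boxdot>\<^bsub>D\<^esub> Id X) \<cdot>\<^bsub>D\<^esub> ?\<rho>
      = (?q \<boxdot>\<^bsub>D\<^esub> Id (X \<otimes> X)) \<cdot>\<^bsub>D\<^esub> (?M (b \<rhd> X) \<cdot>\<^bsub>D\<^esub> (?q \<boxdot>\<^bsub>D\<^esub> Id X)) \<cdot>\<^bsub>D\<^esub> ?M b"
      by (simp add: coaction_def t act_normal)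
    also have "?M (b \<rhd> X) \<cdot>\<^bsub>D\<^esub> (?q \<boxdot>\<^bsub>D\<^esub> Id X) = (?q \<boxdot>\<^bsub>D\<^esub> Id (Y \<otimes> X \<otimes> X)) \<cdot>\<^bsub>D\<^esub> ?M (Y \<lhd> b \<rhd> X)"
      by (rule q_exch) (simp_all add: t)
    also have "(?q \<boxdot>\<^bsub>D\<^esub> Id (X \<otimes> X)) \<cdot>\<^bsub>D\<^esub> ((?q \<boxdot>\<^bsub>D\<^esub> Id (Y \<otimes> X \<otimes> X)) \<cdot>\<^bsub>D\<^esub> ?M (Y \<lhd> b \<rhd> X)) \<cdot>\<^bsub>D\<^esub> ?M b
      = ((?q \<cdot>\<^bsub>D\<^esub> (?q \<boxdot>\<^bsub>D\<^esub> Id Y)) \<boxdot>\<^bsub>D\<^esub> Id (X \<otimes> X)) \<cdot>\<^bsub>D\<^esub> ?M ((Y \<lhd> b \<rhd> X) \<cdot> b)"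
      by (simp add: t act_normal)
    also have "?q \<cdot>\<^bsub>D\<^esub> (?q \<boxdot>\<^bsub>D\<^esub> Id Y) = wact M \<nu> (Y \<otimes> Y) (star Y Y q q)"
      by (rule wact_wact[OF M]) (simp_all add: t)
    also have "(wact M \<nu> (Y \<otimes> Y) (star Y Y q q) \<boxdot>\<^bsub>D\<^esub> Id (X \<otimes> X)) \<cdot>\<^bsub>D\<^esub> ?M ((Y \<lhd> b \<rhd> X) \<cdot> b)
      = (\<nu> \<boxdot>\<^bsub>D\<^esub> Id (X \<otimes> X)) \<cdot>\<^bsub>D\<^esub>
        ?M ((transpose (Y \<otimes> Y) (star Y Y q q) \<rhd> X \<otimes> X) \<cdot> (Y \<lhd> b \<rhd> X) \<cdot> b)"
      by (simp add: \<nu> t act_normal)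
    also have "\<dots> = ((?p \<cdot>\<^bsub>D\<^esub> (?q \<boxdot>\<^bsub>D\<^esub> Id A)) \<boxdot>\<^bsub>D\<^esub> Id (X \<otimes> X)) \<cdot>\<^bsub>D\<^esub> ?M ((Y \<lhd> \<delta>) \<cdot> b)"
      unfolding transpose_star_q_q q_p ..
    also have "\<dots> = (?p \<boxdot>\<^bsub>D\<^esub> Id (X \<otimes> X)) \<cdot>\<^bsub>D\<^esub>
        ((?q \<boxdot>\<^bsub>D\<^esub> Id (A \<otimes> X \<otimes> X)) \<cdot>\<^bsub>D\<^esub> ?M (Y \<lhd> \<delta>)) \<cdot>\<^bsub>D\<^esub> ?M b"
      by (simp add: t act_normal)
    also have "(?q \<boxdot>\<^bsub>D\<^esub> Id (A \<otimes> X \<otimes> X)) \<cdot>\<^bsub>D\<^esub> ?M (Y \<lhd> \<delta>) = ?M \<delta> \<cdot>\<^bsub>D\<^esub> (?q \<boxdot>\<^bsub>D\<^esub> Id X)"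
      by (rule q_exch[symmetric]) (simp_all add: t)
    finally show ?thesis by (simp add: coaction_def t act_normal)
  qed
  \<comment> \<open>This is the agreement of the two actions at \<epsilon>, which acts on a
    \<open>YA\<close>-module as the unit.\<close>
  have counit: "?p \<cdot>\<^bsub>D\<^esub> ?M \<epsilon> \<cdot>\<^bsub>D\<^esub> ?\<rho> = Id\<^bsub>D\<^esub> M"
    using coact_wact[OF M, of \<one> \<epsilon>] wact_\<epsilon>[OF M] by (simp add: coact_def t)
  show ?thesis
    using assoc unit entwine coassoc counit
    by (simp add: entwined_module_def right_module_def module.in_hom_iff t)
qed

lemma coaction_coact: "coaction M (coact M \<mu> \<rho> YA (d \<rhd> A)) = \<rho>" if "entwined M \<mu> \<rho>"
  using that coact_q[OF that] by (simp add: coaction_def wact_coact typed p_q_typing)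

section \<open>Linear and colinear morphisms\<close>

text \<open>The action of \<open>g\<close> is built from \<rho>, \<open>g\<close> and \<mu>, and
  \<open>f\<close> commutes with each of them. The case \<open>g = dA\<close> gives linearity over
  \<open>YA\<close>.\<close>

lemma coact_linear:
  assumes M: "entwined M \<mu> \<rho>" and N: "entwined N \<nu> \<sigma>"
    and f: "f \<in> Ar D" "Dom D f = M" "Cod D f = N"
    and lin: "f \<cdot>\<^bsub>D\<^esub> \<mu> = \<nu> \<cdot>\<^bsub>D\<^esub> (f \<boxdot>\<^bsub>D\<^esub> Id A)"
    and colin: "(f \<boxdot>\<^bsub>D\<^esub> Id X) \<cdot>\<^bsub>D\<^esub> \<rho> = \<sigma> \<cdot>\<^bsub>D\<^esub> f"
    and g: "Z \<in> Ob C" "g \<in> Ar C" "Dom C g = X \<otimes> Z" "Cod C g = A"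
  shows "f \<cdot>\<^bsub>D\<^esub> coact M \<mu> \<rho> Z g = coact N \<nu> \<sigma> Z g \<cdot>\<^bsub>D\<^esub> (f \<boxdot>\<^bsub>D\<^esub> Id Z)"
proof -
  note t = act_typed entwined_module_typing[OF M] entwined_module_typing[OF N] f g
  have "f \<cdot>\<^bsub>D\<^esub> coact M \<mu> \<rho> Z g
    = (f \<cdot>\<^bsub>D\<^esub> \<mu>) \<cdot>\<^bsub>D\<^esub> (Id\<^bsub>D\<^esub> M \<boxdot>\<^bsub>D\<^esub> g) \<cdot>\<^bsub>D\<^esub> (\<rho> \<boxdot>\<^bsub>D\<^esub> Id Z)"
    by (simp add: coact_def t act_normal)
  also have "\<dots> = \<nu> \<cdot>\<^bsub>D\<^esub> ((f \<boxdot>\<^bsub>D\<^esub> Id A) \<cdot>\<^bsub>D\<^esub> (Id\<^bsub>D\<^esub> M \<boxdot>\<^bsub>D\<^esub> g)) \<cdot>\<^bsub>D\<^esub> (\<rho> \<boxdot>\<^bsub>D\<^esub> Id Z)"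
    unfolding lin by (simp add: t act_normal)
  also have "(f \<boxdot>\<^bsub>D\<^esub> Id A) \<cdot>\<^bsub>D\<^esub> (Id\<^bsub>D\<^esub> M \<boxdot>\<^bsub>D\<^esub> g) = (Id\<^bsub>D\<^esub> N \<boxdot>\<^bsub>D\<^esub> g) \<cdot>\<^bsub>D\<^esub> (f \<boxdot>\<^bsub>D\<^esub> Id (X \<otimes> Z))"
    by (rule act_exchange[symmetric]) (simp_all add: t)
  also have "\<nu> \<cdot>\<^bsub>D\<^esub> ((Id\<^bsub>D\<^esub> N \<boxdot>\<^bsub>D\<^esub> g) \<cdot>\<^bsub>D\<^esub> (f \<boxdot>\<^bsub>D\<^esub> Id (X \<otimes> Z))) \<cdot>\<^bsub>D\<^esub> (\<rho> \<boxdot>\<^bsub>D\<^esub> Id Z)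
    = \<nu> \<cdot>\<^bsub>D\<^esub> (Id\<^bsub>D\<^esub> N \<boxdot>\<^bsub>D\<^esub> g) \<cdot>\<^bsub>D\<^esub> (((f \<boxdot>\<^bsub>D\<^esub> Id X) \<cdot>\<^bsub>D\<^esub> \<rho>) \<boxdot>\<^bsub>D\<^esub> Id Z)"
    by (simp add: t act_normal)
  finally show ?thesis unfolding colin by (simp add: coact_def t act_normal)
qed

text \<open>Linearity over \<open>YA\<close> moves \<open>f\<close> past \<nu>, and \<open>f\<close>
  commutes with morphisms of \<open>C\<close> by exchange. The case \<open>g = p\<close> gives
  linearity over \<open>A\<close>; the case \<open>g = q\<close> enters colinearity.\<close>

lemma wact_linear:
  assumes M: "wreath_module M \<mu>" and N: "wreath_module N \<nu>"
    and f: "f \<in> Ar D" "Dom D f = M" "Cod D f = N"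
    and lin: "f \<cdot>\<^bsub>D\<^esub> \<mu> = \<nu> \<cdot>\<^bsub>D\<^esub> (f \<boxdot>\<^bsub>D\<^esub> Id YA)"
    and g: "Z \<in> Ob C" "g \<in> Ar C" "Dom C g = X \<otimes> Z" "Cod C g = A"
  shows "f \<cdot>\<^bsub>D\<^esub> wact M \<mu> Z g = wact N \<nu> Z g \<cdot>\<^bsub>D\<^esub> (f \<boxdot>\<^bsub>D\<^esub> Id Z)"
proof -
  note t = act_typed right_module_typing[OF M] right_module_typing[OF N] f g transpose_typing
  have "f \<cdot>\<^bsub>D\<^esub> wact M \<mu> Z g = (f \<cdot>\<^bsub>D\<^esub> \<mu>) \<cdot>\<^bsub>D\<^esub> (Id\<^bsub>D\<^esub> M \<boxdot>\<^bsub>D\<^esub> transpose Z g)"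
    by (simp add: wact_def t act_normal)
  also have "\<dots> = \<nu> \<cdot>\<^bsub>D\<^esub> ((f \<boxdot>\<^bsub>D\<^esub> Id YA) \<cdot>\<^bsub>D\<^esub> (Id\<^bsub>D\<^esub> M \<boxdot>\<^bsub>D\<^esub> transpose Z g))"
    unfolding lin by (simp add: t act_normal)
  also have "(f \<boxdot>\<^bsub>D\<^esub> Id YA) \<cdot>\<^bsub>D\<^esub> (Id\<^bsub>D\<^esub> M \<boxdot>\<^bsub>D\<^esub> transpose Z g)
      = (Id\<^bsub>D\<^esub> N \<boxdot>\<^bsub>D\<^esub> transpose Z g) \<cdot>\<^bsub>D\<^esub> (f \<boxdot>\<^bsub>D\<^esub> Id Z)"
    by (rule act_exchange[symmetric]) (simp_all add: t)
  finally show ?thesis by (simp add: wact_def t act_normal)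
qed

lemma coaction_linear:
  assumes M: "wreath_module M \<mu>" and N: "wreath_module N \<nu>"
    and f: "f \<in> Ar D" "Dom D f = M" "Cod D f = N"
    and lin: "f \<cdot>\<^bsub>D\<^esub> \<mu> = \<nu> \<cdot>\<^bsub>D\<^esub> (f \<boxdot>\<^bsub>D\<^esub> Id YA)"
  shows "(f \<boxdot>\<^bsub>D\<^esub> Id X) \<cdot>\<^bsub>D\<^esub> coaction M \<mu> = coaction N \<nu> \<cdot>\<^bsub>D\<^esub> f"
proof -
  note t = act_typed right_module_typing[OF M] right_module_typing[OF N] f wact_typing p_q_typing
  have "(f \<boxdot>\<^bsub>D\<^esub> Id X) \<cdot>\<^bsub>D\<^esub> coaction M \<mu>
    = ((f \<cdot>\<^bsub>D\<^esub> wact M \<mu> Y q) \<boxdot>\<^bsub>D\<^esub> Id X) \<cdot>\<^bsub>D\<^esub> (Id\<^bsub>D\<^esub> M \<boxdot>\<^bsub>D\<^esub> b)"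
    by (simp add: coaction_def t act_normal)
  also have "f \<cdot>\<^bsub>D\<^esub> wact M \<mu> Y q = wact N \<nu> Y q \<cdot>\<^bsub>D\<^esub> (f \<boxdot>\<^bsub>D\<^esub> Id Y)"
    by (rule wact_linear[OF M N f lin]) (simp_all add: t)
  also have "((wact N \<nu> Y q \<cdot>\<^bsub>D\<^esub> (f \<boxdot>\<^bsub>D\<^esub> Id Y)) \<boxdot>\<^bsub>D\<^esub> Id X) \<cdot>\<^bsub>D\<^esub> (Id\<^bsub>D\<^esub> M \<boxdot>\<^bsub>D\<^esub> b)
    = (wact N \<nu> Y q \<boxdot>\<^bsub>D\<^esub> Id X) \<cdot>\<^bsub>D\<^esub> ((f \<boxdot>\<^bsub>D\<^esub> Id (Y \<otimes> X)) \<cdot>\<^bsub>D\<^esub> (Id\<^bsub>D\<^esub> M \<boxdot>\<^bsub>D\<^esub> b))"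
    by (simp add: t act_normal)
  also have "(f \<boxdot>\<^bsub>D\<^esub> Id (Y \<otimes> X)) \<cdot>\<^bsub>D\<^esub> (Id\<^bsub>D\<^esub> M \<boxdot>\<^bsub>D\<^esub> b) = (Id\<^bsub>D\<^esub> N \<boxdot>\<^bsub>D\<^esub> b) \<cdot>\<^bsub>D\<^esub> f"
    using act_exchange[of f M N b \<one> "Y \<otimes> X"] by (simp add: t)
  finally show ?thesis by (simp add: coaction_def t act_normal)
qed

section \<open>The two mutually inverse functors\<close>

definition "to_module = (\<lambda>(M, \<mu>, \<rho>). (M, coact M \<mu> \<rho> YA (d \<rhd> A)))"
definition "to_entwined = (\<lambda>(M, \<nu>). (M, wact M \<nu> A p, coaction M \<nu>))"

abbreviation "entwined_cat \<equiv> entwined_category C D A m \<eta> X \<psi> \<delta> \<epsilon>"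
abbreviation "wreath_module_cat \<equiv> module_category C D YA wmult (wreath_unit C Y b \<epsilon>)"

lemma category_entwined_cat: "category entwined_cat"
  by (rule category_entwined_category) (simp_all add: objects)

lemma category_wreath_module_cat: "category wreath_module_cat"
  by (rule category_module_category) (simp add: typed)

lemma functor_to_module:
  "cat_functor entwined_cat wreath_module_cat to_module (\<lambda>(P, f, Q). (to_module P, f, to_module Q))"
proof -
  interpret E: category entwined_cat by (rule category_entwined_cat)
  interpret W: category wreath_module_cat by (rule category_wreath_module_cat)
  show ?thesis
    by unfold_locales
      (auto simp: Defs.hom_def to_module_def entwined_category_Ob entwined_category_Ar
        entwined_category_ops module_category_Ob module_category_Ar module_category_ops
        wreath_module_of_entwined right_linear_def coact_linear typed)
qed

lemma functor_to_entwined: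
  "cat_functor wreath_module_cat entwined_cat to_entwined (\<lambda>(P, f, Q). (to_entwined P, f, to_entwined Q))"
proof -
  interpret E: category entwined_cat by (rule category_entwined_cat)
  interpret W: category wreath_module_cat by (rule category_wreath_module_cat)
  show ?thesis
    by unfold_locales
      (auto simp: Defs.hom_def to_entwined_def entwined_category_Ob entwined_category_Ar
        entwined_category_ops module_category_Ob module_category_Ar module_category_ops
        entwined_of_wreath_module right_linear_def wact_linear coaction_linear typed p_q_typing)
qed

text \<open>By \<open>wact_coact\<close> the \<open>YA\<close>-action lets \<open>p\<close> and
  \<open>q\<close> act as they did before, and those actions determine \<mu> and \<rho>.\<close>

lemma to_entwined_to_module: "entwined M \<mu> \<rho> \<Longrightarrow> to_entwined (to_module (M, \<mu>, \<rho>)) = (M, \<mu>, \<rho>)"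
  by (simp add: to_entwined_def to_module_def wact_coact coact_p coaction_coact typed p_q_typing)

text \<open>This is \<open>coact_wact\<close> at \<open>dA\<close>, whose action on a
  \<open>YA\<close>-module is \<nu>.\<close>

lemma to_module_to_entwined: "wreath_module M \<nu> \<Longrightarrow> to_module (to_entwined (M, \<nu>)) = (M, \<nu>)"
  by (simp add: to_entwined_def to_module_def coact_wact wact_counit typed)

theorem entwined_cat_isomorphic: "isomorphic_categories entwined_cat wreath_module_cat"
  unfolding isomorphic_categories_def
  \<comment> \<open>The arrow maps stay schematic until the functor lemmas fix them. They keep the
    underlying morphism of \<open>D\<close> and change only its tags, so invertibility on arrows
    reduces to the two round trips on objects.\<close>
  by (rule exI[of _ to_module], rule exI, rule exI[of _ to_entwined], rule exI,
      intro conjI, rule functor_to_module, rule functor_to_entwined)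
    (auto simp: entwined_category_Ob entwined_category_Ar module_category_Ob module_category_Ar
      to_entwined_to_module to_module_to_entwined)

end

theorem theorem3p4:
  fixes C :: "('o, 'm, 'x) moncat_scheme"
    and D :: "('d, 'n, 'o, 'm, 'y) actcat_scheme"
    and A X Y :: 'o
    and m \<eta> \<psi> \<delta> \<epsilon> b d :: 'm
  assumes "strict_monoidal_category C"
    and "right_monoidal_action C D"
    and "algebra C A m \<eta>"
    and "cowreath C A m \<eta> X \<psi> \<delta> \<epsilon>"
    and "adjunction C X Y b d"
  shows "isomorphic_categories
    (entwined_category C D A m \<eta> X \<psi> \<delta> \<epsilon>)
    (module_category C D (Y \<otimes>\<^bsub>C\<^esub> A)
      (wreath_mult C A m X \<psi> \<delta> Y b d) (wreath_unit C Y b \<epsilon>))"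
proof -
  interpret right_monoidal_action C D by fact
  interpret cowreath_action C D A X Y m \<eta> \<psi> \<delta> \<epsilon> b d
    using assms by unfold_locales
  show ?thesis by (rule entwined_cat_isomorphic)
qed

end
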